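(* Assume ${\rm ZF}$ is consistent. Then there is no Turing functional $\Phi$ which takes as input the elementary diagram of a structure $\langle M,\in^M,\mathbb{P}\rangle$ with domain $M=\mathbb{N}$, where $\langle M,\in^M\rangle\models{\rm ZF}$ and $\mathbb{P}\in M$ is a partial order in $M$, and outputs an $M$-generic filter $G\subseteq\mathbb{P}$, such that isomorphic copies of the input always result in the corresponding isomorphic copy of $G$ (i.e. whenever $\pi:\langle M,\in^M,\mathbb{P}\rangle\cong\langle M',\in^{M'},\mathbb{P}'\rangle$ with outputs $G,G'$, we have $\pi[G]=G'$).
   Context: A filter $G\subseteq\mathbb{P}$ is $M$-generic if it meets every dense subset of $\mathbb{P}$ belonging to $M$. The elementary diagram of a structure is the set of all first-order formulae with parameters true in it. *)

theory Defs
  imports "HOL-Library.Nat_Bijection"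
begin

section \<open>First-order formulae with membership and equality\<close>

text \<open>Formulae use de Bruijn indices: \<open>All\<close> binds index 0. The type \<open>'t\<close> is the type of
  terms; the language of set theory proper is \<^typ>\<open>nat\<close> \<open>fm\<close>, where the only terms are variables.\<close>

datatype 't fm = Mem 't 't | Eq 't 't | Fls | Imp "'t fm" "'t fm" | All "'t fm"

abbreviation Neg :: "'t fm \<Rightarrow> 't fm" where "Neg \<phi> \<equiv> Imp \<phi> Fls"
abbreviation Conj :: "'t fm \<Rightarrow> 't fm \<Rightarrow> 't fm" where "Conj \<phi> \<psi> \<equiv> Neg (Imp \<phi> (Neg \<psi>))"
abbreviation Disj :: "'t fm \<Rightarrow> 't fm \<Rightarrow> 't fm" where "Disj \<phi> \<psi> \<equiv> Imp (Neg \<phi>) \<psi>"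
abbreviation Iff :: "'t fm \<Rightarrow> 't fm \<Rightarrow> 't fm" where "Iff \<phi> \<psi> \<equiv> Conj (Imp \<phi> \<psi>) (Imp \<psi> \<phi>)"
abbreviation Ex :: "'t fm \<Rightarrow> 't fm" where "Ex \<phi> \<equiv> Neg (All (Neg \<phi>))"

text \<open>\<open>fv tv \<phi>\<close> is the set of free variables of \<open>\<phi>\<close>, where \<open>tv\<close> gives the variables of a term.\<close>

primrec fv :: "('t \<Rightarrow> nat set) \<Rightarrow> 't fm \<Rightarrow> nat set" where
  "fv tv (Mem s t) = tv s \<union> tv t"
| "fv tv (Eq s t) = tv s \<union> tv t"
| "fv tv Fls = {}"
| "fv tv (Imp \<phi> \<psi>) = fv tv \<phi> \<union> fv tv \<psi>"
| "fv tv (All \<phi>) = {n. Suc n \<in> fv tv \<phi>}"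

text \<open>Satisfaction in the structure with domain \<^typ>\<open>'a\<close> and membership relation \<open>E\<close>;
  \<open>ev s t\<close> is the value of the term \<open>t\<close> under the variable assignment \<open>s\<close>.\<close>

primrec sat :: "('a \<Rightarrow> 'a \<Rightarrow> bool) \<Rightarrow> ((nat \<Rightarrow> 'a) \<Rightarrow> 't \<Rightarrow> 'a) \<Rightarrow> (nat \<Rightarrow> 'a) \<Rightarrow> 't fm \<Rightarrow> bool" where
  "sat E ev s (Mem t u) \<longleftrightarrow> E (ev s t) (ev s u)"
| "sat E ev s (Eq t u) \<longleftrightarrow> ev s t = ev s u"
| "sat E ev s Fls \<longleftrightarrow> False"
| "sat E ev s (Imp \<phi> \<psi>) \<longleftrightarrow> (sat E ev s \<phi> \<longrightarrow> sat E ev s \<psi>)"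
| "sat E ev s (All \<phi>) \<longleftrightarrow> (\<forall>x. sat E ev (case_nat x s) \<phi>)"


section \<open>The language of set theory: deduction and the theory ZF\<close>

primrec rename :: "(nat \<Rightarrow> nat) \<Rightarrow> nat fm \<Rightarrow> nat fm" where
  "rename r (Mem m n) = Mem (r m) (r n)"
| "rename r (Eq m n) = Eq (r m) (r n)"
| "rename r Fls = Fls"
| "rename r (Imp \<phi> \<psi>) = Imp (rename r \<phi>) (rename r \<psi>)"
| "rename r (All \<phi>) = All (rename (case_nat 0 (\<lambda>n. Suc (r n))) \<phi>)"

text \<open>Instantiation of variable 0 by the variable \<open>t\<close>, lowering the other indices by one.\<close>

definition inst :: "nat \<Rightarrow> nat fm \<Rightarrow> nat fm" where
  "inst t = rename (case_nat t (\<lambda>n. n))"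

text \<open>Classical natural deduction with equality. In \<open>AllI\<close>, shifting the assumptions by
  \<^const>\<open>Suc\<close> frees index 0, which is the eigenvariable.\<close>

inductive derives :: "nat fm set \<Rightarrow> nat fm \<Rightarrow> bool" where
  Assm: "\<phi> \<in> \<Gamma> \<Longrightarrow> derives \<Gamma> \<phi>"
| ImpI: "derives (insert \<phi> \<Gamma>) \<psi> \<Longrightarrow> derives \<Gamma> (Imp \<phi> \<psi>)"
| ImpE: "derives \<Gamma> (Imp \<phi> \<psi>) \<Longrightarrow> derives \<Gamma> \<phi> \<Longrightarrow> derives \<Gamma> \<psi>"
| Contr: "derives (insert (Neg \<phi>) \<Gamma>) Fls \<Longrightarrow> derives \<Gamma> \<phi>"
| AllI: "derives (rename Suc ` \<Gamma>) \<phi> \<Longrightarrow> derives \<Gamma> (All \<phi>)"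
| AllE: "derives \<Gamma> (All \<phi>) \<Longrightarrow> derives \<Gamma> (inst t \<phi>)"
| EqRefl: "derives \<Gamma> (Eq t t)"
| EqSubst: "derives \<Gamma> (Eq t u) \<Longrightarrow> derives \<Gamma> (inst t \<phi>) \<Longrightarrow> derives \<Gamma> (inst u \<phi>)"

definition consistent :: "nat fm set \<Rightarrow> bool" where
  "consistent T \<longleftrightarrow> \<not> derives T Fls"

text \<open>\<open>\<forall>x y. (\<forall>z. z \<in> x \<longleftrightarrow> z \<in> y) \<longrightarrow> x = y\<close>\<close>
definition extensionality :: "nat fm" where
  "extensionality = All (All (Imp (All (Iff (Mem 0 2) (Mem 0 1))) (Eq 1 0)))"

text \<open>\<open>\<forall>x. (\<exists>y. y \<in> x) \<longrightarrow> (\<exists>y. y \<in> x \<and> \<not> (\<exists>z. z \<in> x \<and> z \<in> y))\<close>\<close>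
definition foundation :: "nat fm" where
  "foundation = All (Imp (Ex (Mem 0 1))
     (Ex (Conj (Mem 0 1) (Neg (Ex (Conj (Mem 0 2) (Mem 0 1)))))))"

text \<open>\<open>\<forall>x y. \<exists>p. \<forall>z. z \<in> p \<longleftrightarrow> z = x \<or> z = y\<close>\<close>
definition pairing :: "nat fm" where
  "pairing = All (All (Ex (All (Iff (Mem 0 1) (Disj (Eq 0 3) (Eq 0 2))))))"

text \<open>\<open>\<forall>x. \<exists>u. \<forall>z. z \<in> u \<longleftrightarrow> (\<exists>y. y \<in> x \<and> z \<in> y)\<close>\<close>
definition union :: "nat fm" where
  "union = All (Ex (All (Iff (Mem 0 1) (Ex (Conj (Mem 0 3) (Mem 1 0))))))"

text \<open>\<open>\<forall>x. \<exists>p. \<forall>z. z \<in> p \<longleftrightarrow> (\<forall>w. w \<in> z \<longrightarrow> w \<in> x)\<close>\<close>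
definition powerset :: "nat fm" where
  "powerset = All (Ex (All (Iff (Mem 0 1) (All (Imp (Mem 0 1) (Mem 0 3))))))"

text \<open>\<open>\<exists>x. (\<exists>e. e \<in> x \<and> (\<forall>z. z \<notin> e)) \<and> (\<forall>y. y \<in> x \<longrightarrow> (\<exists>s. s \<in> x \<and> (\<forall>w. w \<in> s \<longleftrightarrow> w \<in> y \<or> w = y)))\<close>\<close>
definition infinity :: "nat fm" where
  "infinity = Ex (Conj (Ex (Conj (Mem 0 1) (All (Neg (Mem 0 1)))))
     (All (Imp (Mem 0 1)
       (Ex (Conj (Mem 0 2) (All (Iff (Mem 0 1) (Disj (Mem 0 2) (Eq 0 2)))))))))"

text \<open>\<open>\<forall>x. \<exists>y. \<forall>z. z \<in> y \<longleftrightarrow> z \<in> x \<and> \<phi>(z, x, \<dots>)\<close>, where indices 0 and 1 of \<open>\<phi>\<close> stand for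
  \<open>z\<close> and \<open>x\<close>, and the remaining ones are parameters.\<close>
definition separation :: "nat fm \<Rightarrow> nat fm" where
  "separation \<phi> = All (Ex (All (Iff (Mem 0 1)
     (Conj (Mem 0 2) (rename (case_nat 0 (\<lambda>n. n + 2)) \<phi>)))))"

text \<open>\<open>\<forall>x. (\<forall>u. u \<in> x \<longrightarrow> (\<forall>v v'. \<phi>(v, u, x, \<dots>) \<and> \<phi>(v', u, x, \<dots>) \<longrightarrow> v = v')) \<longrightarrow>
        (\<exists>y. \<forall>v. v \<in> y \<longleftrightarrow> (\<exists>u. u \<in> x \<and> \<phi>(v, u, x, \<dots>)))\<close>, where indices 0, 1 and 2 of \<open>\<phi>\<close> stand for
  \<open>v\<close>, \<open>u\<close> and \<open>x\<close>, and the remaining ones are parameters.\<close>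
definition replacement :: "nat fm \<Rightarrow> nat fm" where
  "replacement \<phi> = All (Imp
     (All (Imp (Mem 0 1) (All (All (Imp
        (Conj (rename (case_nat 1 (\<lambda>n. n + 2)) \<phi>) (rename (case_nat 0 (\<lambda>n. n + 2)) \<phi>))
        (Eq 1 0))))))
     (Ex (All (Iff (Mem 0 1)
        (Ex (Conj (Mem 0 3) (rename (case_nat 1 (case_nat 0 (\<lambda>n. n + 3))) \<phi>)))))))"

text \<open>All universal closures of a formula.\<close>
definition closures :: "nat fm \<Rightarrow> nat fm set" where
  "closures \<phi> = {(All ^^ n) \<phi> | n. fv (\<lambda>m. {m}) ((All ^^ n) \<phi>) = {}}"

definition ZF :: "nat fm set" where
  "ZF = {extensionality, foundation, pairing, union, powerset, infinity}
     \<union> (\<Union>\<phi>. closures (separation \<phi>)) \<union> (\<Union>\<phi>. closures (replacement \<phi>))"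

definition models_ZF :: "('a \<Rightarrow> 'a \<Rightarrow> bool) \<Rightarrow> bool" where
  "models_ZF E \<longleftrightarrow> (\<forall>\<phi>\<in>ZF. \<forall>s. sat E (\<lambda>s n. s n) s \<phi>)"


section \<open>Partial orders in a model and generic filters\<close>

definition is_upair :: "('a \<Rightarrow> 'a \<Rightarrow> bool) \<Rightarrow> 'a \<Rightarrow> 'a \<Rightarrow> 'a \<Rightarrow> bool" where
  "is_upair E a b p \<longleftrightarrow> (\<forall>x. E x p \<longleftrightarrow> x = a \<or> x = b)"

text \<open>In the model, \<open>p\<close> is the Kuratowski pair of \<open>a\<close> and \<open>b\<close>.\<close>
definition is_pair :: "('a \<Rightarrow> 'a \<Rightarrow> bool) \<Rightarrow> 'a \<Rightarrow> 'a \<Rightarrow> 'a \<Rightarrow> bool" where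
  "is_pair E a b p \<longleftrightarrow> (\<exists>u v. is_upair E a a u \<and> is_upair E a b v \<and> is_upair E u v p)"

text \<open>A partial order in the model is an element \<open>P\<close> that is, in the model, a pair \<open>(q, r)\<close> of an
  underlying set and an order relation; these are the extensions of \<open>q\<close> and \<open>r\<close>.\<close>

definition po_carrier :: "('a \<Rightarrow> 'a \<Rightarrow> bool) \<Rightarrow> 'a \<Rightarrow> 'a set" where
  "po_carrier E P = {x. \<exists>q r. is_pair E q r P \<and> E x q}"

definition po_rel :: "('a \<Rightarrow> 'a \<Rightarrow> bool) \<Rightarrow> 'a \<Rightarrow> ('a \<times> 'a) set" where
  "po_rel E P = {(x, y). \<exists>q r z. is_pair E q r P \<and> is_pair E x y z \<and> E z r}"

text \<open>As usual in forcing, partial orders are nonempty: the empty one has no filters at all.\<close>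
definition is_po :: "('a \<Rightarrow> 'a \<Rightarrow> bool) \<Rightarrow> 'a \<Rightarrow> bool" where
  "is_po E P \<longleftrightarrow>
     (\<exists>q r. is_pair E q r P \<and> (\<forall>z. E z r \<longrightarrow> (\<exists>x y. E x q \<and> E y q \<and> is_pair E x y z))) \<and>
     partial_order_on (po_carrier E P) (po_rel E P) \<and> po_carrier E P \<noteq> {}"

definition is_filter :: "('a \<Rightarrow> 'a \<Rightarrow> bool) \<Rightarrow> 'a \<Rightarrow> 'a set \<Rightarrow> bool" where
  "is_filter E P G \<longleftrightarrow> G \<subseteq> po_carrier E P \<and> G \<noteq> {} \<and>
     (\<forall>p\<in>G. \<forall>q. (p, q) \<in> po_rel E P \<longrightarrow> q \<in> G) \<and>
     (\<forall>p\<in>G. \<forall>q\<in>G. \<exists>r\<in>G. (r, p) \<in> po_rel E P \<and> (r, q) \<in> po_rel E P)"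

definition is_dense :: "('a \<Rightarrow> 'a \<Rightarrow> bool) \<Rightarrow> 'a \<Rightarrow> 'a set \<Rightarrow> bool" where
  "is_dense E P D \<longleftrightarrow> D \<subseteq> po_carrier E P \<and>
     (\<forall>p\<in>po_carrier E P. \<exists>q\<in>D. (q, p) \<in> po_rel E P)"

definition generic_filter :: "('a \<Rightarrow> 'a \<Rightarrow> bool) \<Rightarrow> 'a \<Rightarrow> 'a set \<Rightarrow> bool" where
  "generic_filter E P G \<longleftrightarrow> is_filter E P G \<and>
     (\<forall>d. is_dense E P {x. E x d} \<longrightarrow> G \<inter> {x. E x d} \<noteq> {})"

text \<open>\<open>\<pi>\<close> is an isomorphism from \<open>\<langle>M, E, P\<rangle>\<close> to \<open>\<langle>M', E', P'\<rangle>\<close>; both domains are whole types.\<close>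
definition is_iso :: "('a \<Rightarrow> 'b) \<Rightarrow> ('a \<Rightarrow> 'a \<Rightarrow> bool) \<Rightarrow> 'a \<Rightarrow> ('b \<Rightarrow> 'b \<Rightarrow> bool) \<Rightarrow> 'b \<Rightarrow> bool" where
  "is_iso \<pi> E P E' P' \<longleftrightarrow> bij \<pi> \<and> (\<forall>x y. E x y \<longleftrightarrow> E' (\<pi> x) (\<pi> y)) \<and> \<pi> P = P'"


section \<open>The elementary diagram as a set of natural numbers\<close>

text \<open>Terms of the language of \<open>\<langle>\<nat>, E, P\<rangle>\<close> with parameters: variables, a name for each element
  of the domain, and the constant symbol interpreted by \<open>P\<close>.\<close>

datatype dterm = Var nat | Par nat | PO

primrec dvars :: "dterm \<Rightarrow> nat set" where
  "dvars (Var n) = {n}"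
| "dvars (Par a) = {}"
| "dvars PO = {}"

primrec dval :: "nat \<Rightarrow> (nat \<Rightarrow> nat) \<Rightarrow> dterm \<Rightarrow> nat" where
  "dval P s (Var n) = s n"
| "dval P s (Par a) = a"
| "dval P s PO = P"

primrec code_dterm :: "dterm \<Rightarrow> nat" where
  "code_dterm (Var n) = list_encode [0, n]"
| "code_dterm (Par a) = list_encode [1, a]"
| "code_dterm PO = list_encode [2]"

primrec code_fm :: "dterm fm \<Rightarrow> nat" where
  "code_fm (Mem t u) = list_encode [0, code_dterm t, code_dterm u]"
| "code_fm (Eq t u) = list_encode [1, code_dterm t, code_dterm u]"
| "code_fm Fls = list_encode [2]"
| "code_fm (Imp \<phi> \<psi>) = list_encode [3, code_fm \<phi>, code_fm \<psi>]"
| "code_fm (All \<phi>) = list_encode [4, code_fm \<phi>]"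

definition elementary_diagram :: "(nat \<Rightarrow> nat \<Rightarrow> bool) \<Rightarrow> nat \<Rightarrow> nat set" where
  "elementary_diagram E P = {code_fm \<phi> | \<phi>. fv dvars \<phi> = {} \<and> (\<forall>s. sat E (dval P) s \<phi>)}"


section \<open>Turing functionals\<close>

text \<open>A Turing functional is given by an oracle Turing machine: a finite transition table for a
  machine with a two-way infinite work tape (symbols are numbers, 0 is the blank) and a read-only
  oracle tape. The table maps a state, the scanned oracle symbol and the scanned work symbol to a
  new state, the work symbol to be written, and a move for the work head and for the oracle head.
  The machine halts when no entry applies; an earlier entry overrides later ones.\<close>

datatype move = MLeft | MStay | MRight

primrec offset :: "move \<Rightarrow> int" where
  "offset MLeft = -1"
| "offset MStay = 0"
| "offset MRight = 1"

type_synonym machine = "((nat \<times> bool option \<times> nat) \<times> (nat \<times> nat \<times> move \<times> move)) list"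

text \<open>State, contents of the work tape, position of the work head, position of the oracle head.\<close>
type_synonym config = "nat \<times> (int \<Rightarrow> nat) \<times> int \<times> int"

text \<open>The characteristic function of the oracle, with blanks (\<^const>\<open>None\<close>) on negative cells.\<close>
definition oracle_tape :: "nat set \<Rightarrow> int \<Rightarrow> bool option" where
  "oracle_tape A i = (if i < 0 then None else Some (nat i \<in> A))"

fun step :: "machine \<Rightarrow> nat set \<Rightarrow> config \<Rightarrow> config option" where
  "step \<Phi> A (q, w, i, j) =
     (case map_of \<Phi> (q, oracle_tape A j, w i) of
        None \<Rightarrow> None
      | Some (q', a, d, e) \<Rightarrow> Some (q', w(i := a), i + offset d, j + offset e))"

text \<open>The input \<open>n\<close> is written as \<open>n + 1\<close> consecutive ones.\<close>
definition initial :: "nat \<Rightarrow> config" where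
  "initial n = (0, \<lambda>i. if 0 \<le> i \<and> i \<le> int n then 1 else 0, 0, 0)"

text \<open>The output of a halting computation is the total number of ones on the work tape.\<close>
definition computes_value :: "machine \<Rightarrow> nat set \<Rightarrow> nat \<Rightarrow> nat \<Rightarrow> bool" where
  "computes_value \<Phi> A n m \<longleftrightarrow>
     (\<exists>q w i j. (\<lambda>c c'. step \<Phi> A c = Some c')\<^sup>*\<^sup>* (initial n) (q, w, i, j) \<and>
        step \<Phi> A (q, w, i, j) = None \<and> m = card {k. w k = 1})"

text \<open>With oracle \<open>A\<close>, the machine computes the characteristic function of \<open>G\<close>.\<close>
definition outputs :: "machine \<Rightarrow> nat set \<Rightarrow> nat set \<Rightarrow> bool" where
  "outputs \<Phi> A G \<longleftrightarrow> (\<forall>n. computes_value \<Phi> A n (if n \<in> G then 1 else 0))"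

end

theory Submission
  imports Defs "HOL-Library.Countable" "HOL-Library.Infinite_Set" "HOL-Combinatorics.Transposition"
begin

text \<open>If \<open>\<Phi>\<close> is equivariant, then \<open>n \<in> G\<close> depends only on finitely much of the diagram, hence on a
  first-order property of a finite tuple containing \<open>n\<close>; so \<open>G\<close> is a union of sets that are definable
  in the model from \<open>P\<close> alone, and each of them is linked (its elements are pairwise compatible).
  Removing a linked set from a dense subset of an atomless partial order leaves a dense set, so any
  finitely many linked definable sets are avoided by some dense set of the model. By compactness there
  is a countable model with a single dense set \<open>c\<close> avoiding all linked sets definable from \<open>P\<close>, and
  there \<open>G\<close> cannot meet \<open>c\<close>.\<close>

text \<open>Removing all linked definable sets at once inside a given model is obstructed by Tarski:
  a formula deciding membership in every definable set uniformly would define truth, so separation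
  handles only finitely many. The requirement for a single \<psi> is first-order in \<open>P\<close>
  and \<open>c\<close>, however, because linkedness enters it as a premise and is thus judged in
  whichever model results.

  Elements are natural numbers that serve as their own names in the diagram, so a halting
  computation sees only names below some bound. A permutation of the naturals can make these names
  denote any other injective tuple; hence definability without parameters besides \<open>P\<close>.
  This needs models whose domain is the whole type, so the Henkin term model is reindexed by the
  naturals, which works because models of ZF are infinite.\<close>

instance fm :: (countable) countable
  by countable_datatype

section \<open>Renaming, soundness and completeness\<close>

abbreviation sats :: "('a \<Rightarrow> 'a \<Rightarrow> bool) \<Rightarrow> (nat \<Rightarrow> 'a) \<Rightarrow> nat fm \<Rightarrow> bool" where
  "sats E s \<phi> \<equiv> sat E (\<lambda>s n. s n) s \<phi>"

abbreviation fvs :: "nat fm \<Rightarrow> nat set" where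
  "fvs \<phi> \<equiv> fv (\<lambda>m. {m}) \<phi>"

lemma finite_fvs: "finite (fvs \<phi>)"
proof (induction \<phi>)
  case (All \<phi>)
  have "{n. Suc n \<in> fvs \<phi>} = Suc -` fvs \<phi>" by auto
  then show ?case using All by (simp add: finite_vimageI)
qed auto

lemma sat_cong_fv: "(\<And>n. n \<in> fvs \<phi> \<Longrightarrow> s n = s' n) \<Longrightarrow> sats E s \<phi> = sats E s' \<phi>"
proof (induction \<phi> arbitrary: s s')
  case (Imp \<phi> \<psi>)
  then show ?case by (metis UnCI fv.simps(4) sat.simps(4))
next
  case (All \<phi>)
  have "sats E (case_nat x s) \<phi> = sats E (case_nat x s') \<phi>" for x
    by (rule All.IH) (auto split: nat.split intro: All.prems)
  then show ?case by simp
qed auto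

lemma sat_rename: "sats E s (rename r \<phi>) = sats E (s \<circ> r) \<phi>"
proof (induction \<phi> arbitrary: s r)
  case (All \<phi>)
  have "case_nat x s \<circ> case_nat 0 (\<lambda>n. Suc (r n)) = case_nat x (s \<circ> r)" for x
    by (auto split: nat.split)
  then show ?case by (simp only: rename.simps sat.simps All.IH)
qed auto

lemma sat_inst: "sats E s (inst t \<phi>) = sats E (case_nat (s t) s) \<phi>"
proof -
  have "s \<circ> case_nat t (\<lambda>n. n) = case_nat (s t) s"
    by (auto split: nat.split)
  then show ?thesis by (simp add: inst_def sat_rename)
qed

lemma rename_cong: "(\<And>n. n \<in> fvs \<phi> \<Longrightarrow> r n = r' n) \<Longrightarrow> rename r \<phi> = rename r' \<phi>"
proof (induction \<phi> arbitrary: r r')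
  case (Imp \<phi> \<psi>)
  then show ?case by (metis UnCI fv.simps(4) rename.simps(4))
next
  case (All \<phi>)
  have "rename (case_nat 0 (\<lambda>n. Suc (r n))) \<phi> = rename (case_nat 0 (\<lambda>n. Suc (r' n))) \<phi>"
    by (rule All.IH) (auto split: nat.split intro: All.prems)
  then show ?case by simp
qed auto

lemma rename_rename: "rename r (rename q \<phi>) = rename (r \<circ> q) \<phi>"
proof (induction \<phi> arbitrary: r q)
  case (All \<phi>)
  have "case_nat 0 (\<lambda>n. Suc (r n)) \<circ> case_nat 0 (\<lambda>n. Suc (q n)) = case_nat 0 (\<lambda>n. Suc ((r \<circ> q) n))"
    by (auto split: nat.split)
  then show ?case by (simp only: rename.simps All.IH)
qed auto

lemma rename_id: "rename (\<lambda>n. n) \<phi> = \<phi>"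
proof (induction \<phi>)
  case (All \<phi>)
  have "case_nat 0 (\<lambda>n. Suc n) = (\<lambda>n. n)"
    by (auto split: nat.split)
  then show ?case using All by simp
qed auto

lemma rename_inst: "rename r (inst t \<phi>) = inst (r t) (rename (case_nat 0 (\<lambda>n. Suc (r n))) \<phi>)"
proof -
  have "r \<circ> case_nat t (\<lambda>n. n) = case_nat (r t) (\<lambda>n. n) \<circ> case_nat 0 (\<lambda>n. Suc (r n))"
    by (auto split: nat.split)
  then show ?thesis by (simp add: inst_def rename_rename)
qed

lemma inst_rename_lift: "inst t (rename (case_nat 0 (\<lambda>n. Suc (r n))) \<phi>) = rename (case_nat t r) \<phi>"
proof -
  have "case_nat t (\<lambda>n. n) \<circ> case_nat 0 (\<lambda>n. Suc (r n)) = case_nat t r"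
    by (auto split: nat.split)
  then show ?thesis by (simp add: inst_def rename_rename)
qed

section \<open>Soundness and admissible rules of the deduction system\<close>

lemma derives_sound: "derives \<Gamma> \<phi> \<Longrightarrow> (\<And>\<gamma>. \<gamma> \<in> \<Gamma> \<Longrightarrow> sats E s \<gamma>) \<Longrightarrow> sats E s \<phi>"
proof (induction arbitrary: s rule: derives.induct)
  case (ImpI \<phi> \<Gamma> \<psi>)
  then show ?case by (metis insert_iff sat.simps(4))
next
  case (Contr \<phi> \<Gamma>)
  then show ?case by (metis insert_iff sat.simps(3) sat.simps(4))
next
  case (AllI \<Gamma> \<phi>)
  have "sats E (case_nat x s) \<phi>" for x
  proof (rule AllI.IH)
    fix \<gamma> assume "\<gamma> \<in> rename Suc ` \<Gamma>"
    then obtain \<delta> where "\<delta> \<in> \<Gamma>" "\<gamma> = rename Suc \<delta>" by blast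
    moreover have "case_nat x s \<circ> Suc = s" by auto
    ultimately show "sats E (case_nat x s) \<gamma>"
      using AllI.prems by (simp add: sat_rename)
  qed
  then show ?case by simp
next
  case (EqSubst \<Gamma> t u \<phi>)
  then show ?case by (metis sat.simps(2) sat_inst)
qed (auto simp: sat_inst)

lemma derives_weaken: "derives \<Gamma> \<phi> \<Longrightarrow> \<Gamma> \<subseteq> \<Delta> \<Longrightarrow> derives \<Delta> \<phi>"
proof (induction arbitrary: \<Delta> rule: derives.induct)
  case (ImpI \<phi> \<Gamma> \<psi>)
  then show ?case by (meson derives.ImpI insert_mono)
next
  case (Contr \<phi> \<Gamma>)
  then show ?case by (meson derives.Contr insert_mono)
next
  case (AllI \<Gamma> \<phi>)
  then show ?case by (meson derives.AllI image_mono)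
next
  case (Assm \<phi> \<Gamma>)
  then show ?case by (meson derives.Assm subsetD)
next
  case (ImpE \<Gamma> \<phi> \<psi>)
  then show ?case by (meson derives.ImpE)
next
  case (AllE \<Gamma> \<phi> t)
  then show ?case by (meson derives.AllE)
next
  case (EqRefl \<Gamma> t)
  show ?case by (rule derives.EqRefl)
next
  case (EqSubst \<Gamma> t u \<phi>)
  then show ?case by (meson derives.EqSubst)
qed

lemma derives_rename: "derives \<Gamma> \<phi> \<Longrightarrow> derives (rename r ` \<Gamma>) (rename r \<phi>)"
proof (induction arbitrary: r rule: derives.induct)
  case (ImpI \<phi> \<Gamma> \<psi>)
  then show ?case using derives.ImpI by (metis image_insert rename.simps(4))
next
  case (ImpE \<Gamma> \<phi> \<psi>)
  then show ?case using derives.ImpE by (metis rename.simps(4))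
next
  case (Contr \<phi> \<Gamma>)
  then show ?case using derives.Contr by (metis image_insert rename.simps(3,4))
next
  case (AllI \<Gamma> \<phi>)
  have "case_nat 0 (\<lambda>n. Suc (r n)) \<circ> Suc = Suc \<circ> r"
    by auto
  then have "rename (case_nat 0 (\<lambda>n. Suc (r n))) ` rename Suc ` \<Gamma> = rename Suc ` rename r ` \<Gamma>"
    by (simp add: image_image rename_rename)
  then show ?case using AllI.IH[of "case_nat 0 (\<lambda>n. Suc (r n))"] by (simp add: derives.AllI)
next
  case (AllE \<Gamma> \<phi> t)
  then show ?case using derives.AllE by (simp add: rename_inst)
next
  case (EqSubst \<Gamma> t u \<phi>)
  then show ?case
    using derives.EqSubst[of _ "r t" "r u"] by (simp add: rename_inst)
qed (auto intro: derives.Assm derives.EqRefl)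

lemma derives_finite: "derives \<Gamma> \<phi> \<Longrightarrow> \<exists>\<Delta>\<subseteq>\<Gamma>. finite \<Delta> \<and> derives \<Delta> \<phi>"
proof (induction rule: derives.induct)
  case (Assm \<phi> \<Gamma>)
  then show ?case by (intro exI[of _ "{\<phi>}"]) (auto intro: derives.Assm)
next
  case (ImpI \<phi> \<Gamma> \<psi>)
  then obtain \<Delta> where \<Delta>: "\<Delta> \<subseteq> insert \<phi> \<Gamma>" "finite \<Delta>" "derives \<Delta> \<psi>" by blast
  then have "derives (insert \<phi> (\<Delta> - {\<phi>})) \<psi>" by (auto intro: derives_weaken)
  with \<Delta> show ?case by (intro exI[of _ "\<Delta> - {\<phi>}"]) (auto intro: derives.ImpI)
next
  case (ImpE \<Gamma> \<phi> \<psi>)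
  then obtain \<Delta> \<Delta>' where "\<Delta> \<subseteq> \<Gamma>" "finite \<Delta>" "derives \<Delta> (Imp \<phi> \<psi>)"
    "\<Delta>' \<subseteq> \<Gamma>" "finite \<Delta>'" "derives \<Delta>' \<phi>" by blast
  moreover from this have "derives (\<Delta> \<union> \<Delta>') \<psi>"
    by (meson derives.ImpE derives_weaken sup_ge1 sup_ge2)
  ultimately show ?case by (intro exI[of _ "\<Delta> \<union> \<Delta>'"]) simp
next
  case (Contr \<phi> \<Gamma>)
  then obtain \<Delta> where \<Delta>: "\<Delta> \<subseteq> insert (Neg \<phi>) \<Gamma>" "finite \<Delta>" "derives \<Delta> Fls" by blast
  then have "derives (insert (Neg \<phi>) (\<Delta> - {Neg \<phi>})) Fls" by (auto intro: derives_weaken)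
  with \<Delta> show ?case by (intro exI[of _ "\<Delta> - {Neg \<phi>}"]) (auto intro: derives.Contr)
next
  case (AllI \<Gamma> \<phi>)
  then obtain \<Delta> where "\<Delta> \<subseteq> rename Suc ` \<Gamma>" "finite \<Delta>" "derives \<Delta> \<phi>" by blast
  then show ?case by (metis derives.AllI finite_subset_image)
next
  case (AllE \<Gamma> \<phi> t)
  then show ?case by (meson derives.AllE)
next
  case (EqRefl \<Gamma> t)
  show ?case by (intro exI[of _ "{}"]) (auto intro: derives.EqRefl)
next
  case (EqSubst \<Gamma> t u \<phi>)
  then obtain \<Delta> \<Delta>' where "\<Delta> \<subseteq> \<Gamma>" "finite \<Delta>" "derives \<Delta> (Eq t u)"
    "\<Delta>' \<subseteq> \<Gamma>" "finite \<Delta>'" "derives \<Delta>' (inst t \<phi>)" by blast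
  moreover from this have "derives (\<Delta> \<union> \<Delta>') (inst u \<phi>)"
    by (meson derives.EqSubst derives_weaken sup_ge1 sup_ge2)
  ultimately show ?case by (intro exI[of _ "\<Delta> \<union> \<Delta>'"]) simp
qed

lemma consistentI_finite_sat:
  assumes "\<And>\<Delta>. finite \<Delta> \<Longrightarrow> \<Delta> \<subseteq> \<Gamma> \<Longrightarrow> \<exists>(E :: 'a \<Rightarrow> 'a \<Rightarrow> bool) s. \<forall>\<gamma>\<in>\<Delta>. sats E s \<gamma>"
  shows "consistent \<Gamma>"
  unfolding consistent_def
proof
  assume "derives \<Gamma> Fls"
  then obtain \<Delta> where "\<Delta> \<subseteq> \<Gamma>" "finite \<Delta>" and d: "derives \<Delta> Fls" using derives_finite by blast
  with assms obtain E :: "'a \<Rightarrow> 'a \<Rightarrow> bool" and s where "\<forall>\<gamma>\<in>\<Delta>. sats E s \<gamma>" by blast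
  then have "sats E s Fls" using derives_sound[OF d, of E s] by blast
  then show False by simp
qed

section \<open>Henkin extensions of consistent sets\<close>

text \<open>\<open>rename r\<close> turns \<open>inst v \<phi>\<close> back into \<phi> and acts on
  \<open>A\<close> like \<open>Suc\<close>, since \<open>v\<close> is free nowhere in
  \<open>A\<close>. A derivation of the instance thus becomes one with eigenvariable 0, to which
  \<open>AllI\<close> applies.\<close>

lemma consistent_witness:
  assumes con: "consistent A" and neg: "Neg (All \<phi>) \<in> A"
    and v: "v \<notin> \<Union>(fvs ` A)"
  shows "consistent (insert (Neg (inst v \<phi>)) A)"
  unfolding consistent_def
proof
  assume "derives (insert (Neg (inst v \<phi>)) A) Fls"
  then have d: "derives A (inst v \<phi>)" by (rule derives.Contr)
  define r where "r n = (if n = v then 0 else Suc n)" for n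
  have "rename r \<gamma> = rename Suc \<gamma>" if "\<gamma> \<in> A" for \<gamma>
    using v that by (intro rename_cong) (auto simp: r_def)
  then have im: "rename r ` A = rename Suc ` A" by (auto simp: image_iff)
  have "n \<noteq> v" if "Suc n \<in> fvs \<phi>" for n
  proof -
    have "n \<in> fvs (Neg (All \<phi>))" using that by simp
    then show ?thesis using v neg by blast
  qed
  then have "rename (r \<circ> case_nat v (\<lambda>n. n)) \<phi> = rename (\<lambda>n. n) \<phi>"
    by (intro rename_cong) (auto simp: r_def split: nat.split)
  then have "rename r (inst v \<phi>) = \<phi>"
    by (simp add: inst_def rename_rename rename_id)
  with derives_rename[OF d, of r] im have "derives (rename Suc ` A) \<phi>" by simp
  then have "derives A (All \<phi>)" by (rule derives.AllI)
  with neg have "derives A Fls" by (meson derives.Assm derives.ImpE)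
  with con show False by (simp add: consistent_def)
qed

text \<open>One stage of the Lindenbaum-Henkin construction. Witnesses are fresh variables rather
  than new constants, which is why the set of free variables is kept finite along the
  stages.\<close>

definition henkin_step :: "nat fm \<Rightarrow> nat fm set \<Rightarrow> nat fm set \<Rightarrow> bool" where
  "henkin_step \<phi> A B \<longleftrightarrow> A \<subseteq> B \<and> (consistent (insert \<phi> A) \<longrightarrow> \<phi> \<in> B) \<and>
    (\<forall>\<psi>. \<phi> = Neg (All \<psi>) \<longrightarrow> \<phi> \<in> B \<longrightarrow> (\<exists>v. Neg (inst v \<psi>) \<in> B))"

lemma henkin_step_exists:
  assumes con: "consistent A" and fin: "finite (\<Union>(fvs ` A))"
  shows "\<exists>B. consistent B \<and> finite (\<Union>(fvs ` B)) \<and> henkin_step \<phi> A B"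
proof (cases "consistent (insert \<phi> A)")
  case c: True
  have fin': "finite (\<Union>(fvs ` insert \<phi> A))" using fin finite_fvs by simp
  show ?thesis
  proof (cases "\<exists>\<psi>. \<phi> = Neg (All \<psi>)")
    case True
    then obtain \<psi> where \<psi>: "\<phi> = Neg (All \<psi>)" by blast
    obtain v where "v \<notin> \<Union>(fvs ` insert \<phi> A)"
      using fin' ex_new_if_finite infinite_UNIV_nat by blast
    with consistent_witness[OF c, of \<psi> v] \<psi>
    have "consistent (insert (Neg (inst v \<psi>)) (insert \<phi> A))" by blast
    moreover have "finite (\<Union>(fvs ` insert (Neg (inst v \<psi>)) (insert \<phi> A)))"
      using fin' finite_fvs[of "Neg (inst v \<psi>)"] by simp
    ultimately show ?thesis using \<psi>
      by (intro exI[of _ "insert (Neg (inst v \<psi>)) (insert \<phi> A)"]) (auto simp: henkin_step_def)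
  next
    case False
    with c fin' show ?thesis
      by (intro exI[of _ "insert \<phi> A"]) (simp add: henkin_step_def subset_insertI)
  qed
next
  case False
  then have "\<phi> \<notin> A" using con by (metis insert_absorb)
  with False con fin show ?thesis by (intro exI[of _ A]) (auto simp: henkin_step_def)
qed

locale henkin =
  fixes H :: "nat fm set"
  assumes con: "consistent H"
    and maximal: "consistent (insert \<phi> H) \<Longrightarrow> \<phi> \<in> H"
    and witness: "Neg (All \<psi>) \<in> H \<Longrightarrow> \<exists>v. Neg (inst v \<psi>) \<in> H"

lemma henkin_extension:
  assumes con: "consistent \<Gamma>" and fin: "finite (\<Union>(fvs ` \<Gamma>))"
  shows "\<exists>H. \<Gamma> \<subseteq> H \<and> henkin H"
proof -
  \<comment> \<open>The clause for \<open>n = 0\<close> fixes the start of the chain; stage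
    \<open>n\<close> treats the formula \<open>from_nat n\<close>.\<close>
  have "\<exists>f. \<forall>n. ((consistent (f n) \<and> finite (\<Union>(fvs ` f n))) \<and> (n = 0 \<longrightarrow> f n = \<Gamma>)) \<and>
      henkin_step (from_nat n) (f n) (f (Suc n))"
  proof (rule dependent_nat_choice)
    show "\<exists>A. (consistent A \<and> finite (\<Union>(fvs ` A))) \<and> ((0::nat) = 0 \<longrightarrow> A = \<Gamma>)" using con fin by blast
  next
    fix A and n :: nat assume "(consistent A \<and> finite (\<Union>(fvs ` A))) \<and> (n = 0 \<longrightarrow> A = \<Gamma>)"
    then obtain B where "consistent B" "finite (\<Union>(fvs ` B))" "henkin_step (from_nat n) A B"
      using henkin_step_exists[of A "from_nat n"] by blast
    then show "\<exists>B. ((consistent B \<and> finite (\<Union>(fvs ` B))) \<and> (Suc n = 0 \<longrightarrow> B = \<Gamma>)) \<and>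
        henkin_step (from_nat n) A B" by (intro exI[of _ B]) simp
  qed
  then obtain f where f: "\<And>n. consistent (f n)" "f 0 = \<Gamma>"
    and step: "\<And>n. henkin_step (from_nat n) (f n) (f (Suc n))" by (metis (no_types))
  have sub: "f n \<subseteq> f (Suc n)" and dec: "consistent (insert (from_nat n) (f n)) \<Longrightarrow> from_nat n \<in> f (Suc n)"
    and wit: "\<And>\<psi>. from_nat n = Neg (All \<psi>) \<Longrightarrow> from_nat n \<in> f (Suc n) \<Longrightarrow> \<exists>v. Neg (inst v \<psi>) \<in> f (Suc n)" for n
    using step[of n] by (auto simp: henkin_step_def)
  have mono: "f m \<subseteq> f n" if "m \<le> n" for m n
    using sub that by (rule lift_Suc_mono_le)
  let ?H = "\<Union>n. f n"
  have "henkin ?H"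
  proof
    show "consistent ?H"
      unfolding consistent_def
    proof
      assume "derives ?H Fls"
      then obtain \<Delta> where \<Delta>: "\<Delta> \<subseteq> ?H" "finite \<Delta>" and d: "derives \<Delta> Fls" using derives_finite by blast
      have "\<exists>n. \<Delta> \<subseteq> f n"
        using \<Delta>(2,1)
      proof (induction \<Delta> rule: finite_induct)
        case (insert \<phi> \<Delta>)
        then obtain m n where "\<Delta> \<subseteq> f n" "\<phi> \<in> f m" by auto
        then have "insert \<phi> \<Delta> \<subseteq> f (max m n)"
          using mono[of m "max m n"] mono[of n "max m n"] by auto
        then show ?case by blast
      qed simp
      with d f(1) show False by (meson consistent_def derives_weaken)
    qed
  next
    fix \<phi> assume c: "consistent (insert \<phi> ?H)"
    have "insert \<phi> (f (to_nat \<phi>)) \<subseteq> insert \<phi> ?H" by auto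
    with c have "consistent (insert \<phi> (f (to_nat \<phi>)))"
      unfolding consistent_def using derives_weaken by blast
    with dec[of "to_nat \<phi>"] show "\<phi> \<in> ?H" by auto
  next
    fix \<psi> assume "Neg (All \<psi>) \<in> ?H"
    let ?n = "to_nat (Neg (All \<psi>))"
    from \<open>Neg (All \<psi>) \<in> ?H\<close> obtain m where "Neg (All \<psi>) \<in> f m" by blast
    then have m: "Neg (All \<psi>) \<in> f (max m ?n)" using mono[of m "max m ?n"] by auto
    \<comment> \<open>The formula is only known to be present at some stage \<open>m\<close>. Its
      own stage accepts it all the same, as it lies together with \<open>f ?n\<close> in one
      consistent member of the chain.\<close>
    have "consistent (insert (Neg (All \<psi>)) (f ?n))"
    proof -
      have "insert (Neg (All \<psi>)) (f ?n) \<subseteq> f (max m ?n)"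
        using m mono[of ?n "max m ?n"] by auto
      then show ?thesis using f(1) unfolding consistent_def using derives_weaken by blast
    qed
    with wit[of ?n \<psi>] dec[of ?n] show "\<exists>v. Neg (inst v \<psi>) \<in> ?H" by auto
  qed
  moreover have "\<Gamma> \<subseteq> ?H" using f(2) by blast
  ultimately show ?thesis by blast
qed

section \<open>The term model of a Henkin set\<close>

context henkin
begin

lemma closed: "derives H \<phi> \<Longrightarrow> \<phi> \<in> H"
proof (rule maximal, unfold consistent_def, rule notI)
  assume "derives H \<phi>" "derives (insert \<phi> H) Fls"
  then have "derives H Fls" by (meson derives.ImpI derives.ImpE)
  then show False using con by (simp add: consistent_def)
qed

lemma Fls_iff: "Fls \<in> H \<longleftrightarrow> False"
  using con by (auto simp: consistent_def intro: derives.Assm)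

lemma Imp_iff: "Imp \<phi> \<psi> \<in> H \<longleftrightarrow> (\<phi> \<in> H \<longrightarrow> \<psi> \<in> H)"
proof
  assume "Imp \<phi> \<psi> \<in> H"
  then show "\<phi> \<in> H \<longrightarrow> \<psi> \<in> H" by (meson closed derives.Assm derives.ImpE)
next
  assume r: "\<phi> \<in> H \<longrightarrow> \<psi> \<in> H"
  have "derives (insert \<phi> H) \<psi>"
  proof (cases "\<phi> \<in> H")
    case True
    then show ?thesis using r by (simp add: derives.Assm)
  next
    case False
    then have "derives (insert \<phi> H) Fls" using maximal by (auto simp: consistent_def)
    then show ?thesis by (meson derives.Contr derives_weaken subset_insertI)
  qed
  then show "Imp \<phi> \<psi> \<in> H" by (intro closed derives.ImpI)
qed

lemma All_iff: "All \<phi> \<in> H \<longleftrightarrow> (\<forall>t. inst t \<phi> \<in> H)"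
proof
  assume "All \<phi> \<in> H"
  then show "\<forall>t. inst t \<phi> \<in> H" by (meson closed derives.Assm derives.AllE)
next
  assume "\<forall>t. inst t \<phi> \<in> H"
  then show "All \<phi> \<in> H" using witness[of \<phi>] by (auto simp: Imp_iff Fls_iff)
qed

lemma rename_All_iff: "rename r (All \<phi>) \<in> H \<longleftrightarrow> (\<forall>t. rename (case_nat t r) \<phi> \<in> H)"
  by (simp add: All_iff inst_rename_lift)

lemma Eq_refl: "Eq t t \<in> H"
  by (intro closed derives.EqRefl)

lemma Eq_subst: "Eq t u \<in> H \<Longrightarrow> inst t \<phi> \<in> H \<Longrightarrow> inst u \<phi> \<in> H"
  by (meson closed derives.Assm derives.EqSubst)

lemma Eq_sym: "Eq t u \<in> H \<Longrightarrow> Eq u t \<in> H"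
  using Eq_subst[of t u "Eq 0 (Suc t)"] Eq_refl by (simp add: inst_def)

lemma Eq_trans: "Eq t u \<in> H \<Longrightarrow> Eq u v \<in> H \<Longrightarrow> Eq t v \<in> H"
  using Eq_subst[of u v "Eq (Suc t) 0"] by (simp add: inst_def)

lemma Mem_cong: "Eq t u \<in> H \<Longrightarrow> Eq v w \<in> H \<Longrightarrow> Mem t v \<in> H \<Longrightarrow> Mem u w \<in> H"
  using Eq_subst[of t u "Mem 0 (Suc v)"] Eq_subst[of v w "Mem (Suc u) 0"] by (simp add: inst_def)

text \<open>Elements of the term model are variables modulo \<open>Eq\<close>; this makes truth
  independent of the chosen representatives.\<close>

lemma rename_Eq_cong:
  "(\<And>n. Eq (r n) (r' n) \<in> H) \<Longrightarrow> rename r \<phi> \<in> H \<longleftrightarrow> rename r' \<phi> \<in> H"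
proof (induction \<phi> arbitrary: r r')
  case (Mem m n)
  then show ?case by (auto intro: Mem_cong Eq_sym)
next
  case (Eq m n)
  then show ?case by (auto intro: Eq_trans Eq_sym)
next
  case (Imp \<phi> \<psi>)
  then show ?case by (metis Imp_iff rename.simps(4))
next
  case (All \<phi>)
  have "rename (case_nat t r) \<phi> \<in> H \<longleftrightarrow> rename (case_nat t r') \<phi> \<in> H" for t
    by (rule All.IH) (auto split: nat.split simp: Eq_refl All.prems)
  then show ?case unfolding rename_All_iff by blast
qed auto

text \<open>With finitely many classes, pairing and union would assemble a set \<open>Y\<close>
  having everything as a member, itself included, against foundation for the singleton of
  \<open>Y\<close>. Hence the term model can be indexed by all natural numbers.\<close>

lemma infinite_Eq_classes:
  assumes ZF: "ZF \<subseteq> H" and S: "finite S" "\<And>x. \<exists>y\<in>S. Eq x y \<in> H"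
  shows False
proof -
  note H_iff = All_iff Imp_iff Fls_iff inst_def
  have "pairing \<in> H" using ZF by (auto simp: ZF_def)
  then have p: "\<And>x y. \<exists>p. \<forall>z. Mem z p \<in> H \<longleftrightarrow> Eq z x \<in> H \<or> Eq z y \<in> H"
    unfolding pairing_def by (simp add: H_iff) meson
  have "union \<in> H" using ZF by (auto simp: ZF_def)
  then have u: "\<And>x. \<exists>u. \<forall>z. Mem z u \<in> H \<longleftrightarrow> (\<exists>y. Mem y x \<in> H \<and> Mem z y \<in> H)"
    unfolding union_def by (simp add: H_iff) meson
  have "foundation \<in> H" using ZF by (auto simp: ZF_def)
  then have f: "\<And>x y. Mem y x \<in> H \<Longrightarrow> \<exists>y. Mem y x \<in> H \<and> \<not> (\<exists>z. Mem z x \<in> H \<and> Mem z y \<in> H)"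
    unfolding foundation_def by (simp add: H_iff) meson
  have "\<exists>Y. \<forall>y\<in>S. Mem y Y \<in> H"
    using S(1)
  proof (induction S rule: finite_induct)
    case (insert a S)
    then obtain Y where Y: "\<forall>y\<in>S. Mem y Y \<in> H" by blast
    obtain q where q: "\<And>z. Mem z q \<in> H \<longleftrightarrow> Eq z a \<in> H \<or> Eq z a \<in> H" using p[of a a] by blast
    obtain w where w: "\<And>z. Mem z w \<in> H \<longleftrightarrow> Eq z Y \<in> H \<or> Eq z q \<in> H" using p[of Y q] by blast
    obtain U where "\<And>z. Mem z U \<in> H \<longleftrightarrow> (\<exists>y. Mem y w \<in> H \<and> Mem z y \<in> H)" using u[of w] by blast
    then show ?case using q w Y Eq_refl by (intro exI[of _ U]) blast
  qed simp
  then obtain Y where "\<forall>y\<in>S. Mem y Y \<in> H" by blast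
  then have Y: "Mem x Y \<in> H" for x using S(2)[of x] by (meson Mem_cong Eq_sym Eq_refl)
  obtain q where q: "\<And>z. Mem z q \<in> H \<longleftrightarrow> Eq z Y \<in> H" using p[of Y Y] by blast
  then have "Mem Y q \<in> H" using Eq_refl by blast
  with f obtain y where "Mem y q \<in> H" "\<not> Mem Y y \<in> H" by blast
  with q Y[of Y] show False by (meson Mem_cong Eq_sym Eq_refl)
qed

text \<open>The domain consists of the classes of variables modulo \<open>Eq\<close>, given by their
  least members \<open>rep x\<close>; \<open>f\<close> enumerates these, and \<open>g\<close> sends
  a variable to the index of its class.\<close>

lemma ex_model:
  assumes ZF: "ZF \<subseteq> H"
  shows "\<exists>(E :: nat \<Rightarrow> nat \<Rightarrow> bool) s. \<forall>\<phi>\<in>H. sats E s \<phi>"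
proof -
  define rep where "rep x = (LEAST y. Eq x y \<in> H)" for x
  have rep: "Eq x (rep x) \<in> H" for x
    unfolding rep_def by (rule LeastI) (rule Eq_refl)
  have rep_eq: "rep x = rep y" if "Eq x y \<in> H" for x y
    unfolding rep_def using that by (metis Eq_sym Eq_trans)
  have inf: "infinite (range rep)"
    using infinite_Eq_classes[OF ZF, of "range rep"] rep by blast
  define f where "f = enumerate (range rep)"
  have f: "bij_betw f UNIV (range rep)"
    unfolding f_def using inf by (rule bij_enumerate)
  have f_inj: "Eq (f i) (f j) \<in> H \<longleftrightarrow> i = j" for i j
  proof
    assume e: "Eq (f i) (f j) \<in> H"
    have "f i \<in> range rep" "f j \<in> range rep" using f by (auto simp: bij_betw_def)
    then obtain x y where xy: "f i = rep x" "f j = rep y" by blast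
    have "Eq x y \<in> H" using e xy rep by (metis Eq_sym Eq_trans)
    then have "f i = f j" using xy rep_eq by simp
    then show "i = j" using f by (simp add: bij_betw_def inj_eq)
  qed (simp add: Eq_refl)
  define g where "g x = (SOME i. f i = rep x)" for x
  have g: "Eq (f (g x)) x \<in> H" for x
  proof -
    have "\<exists>i. f i = rep x" using f by (metis UNIV_I bij_betw_def imageE rangeI)
    then have "f (g x) = rep x" unfolding g_def by (rule someI_ex)
    then show ?thesis by (simp add: rep Eq_sym)
  qed
  let ?E = "\<lambda>i j. Mem (f i) (f j) \<in> H"
  \<comment> \<open>Truth lemma: an assignment of indices acts on formulae as the renaming
    \<open>f \<circ> s\<close>.\<close>
  have truth: "sats ?E s \<phi> \<longleftrightarrow> rename (f \<circ> s) \<phi> \<in> H" for s \<phi>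
  proof (induction \<phi> arbitrary: s)
    case (Eq m n)
    then show ?case using f_inj[of "s m" "s n"] by auto
  next
    case (All \<phi>)
    have lift: "f \<circ> case_nat x s = case_nat (f x) (f \<circ> s)" for x by (auto split: nat.split)
    \<comment> \<open>Every variable is equal in \<open>H\<close> to a representative, so
      quantifying over indices covers all instances.\<close>
    have "rename (case_nat (f (g t)) (f \<circ> s)) \<phi> \<in> H \<longleftrightarrow> rename (case_nat t (f \<circ> s)) \<phi> \<in> H" for t
      by (rule rename_Eq_cong) (auto split: nat.split simp: g Eq_refl)
    then have "(\<forall>x. rename (case_nat (f x) (f \<circ> s)) \<phi> \<in> H) \<longleftrightarrow> (\<forall>t. rename (case_nat t (f \<circ> s)) \<phi> \<in> H)"
      by metis
    then show ?case unfolding rename_All_iff sat.simps All.IH lift .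
  qed (simp_all add: Imp_iff Fls_iff)
  have "sats ?E g \<phi>" if "\<phi> \<in> H" for \<phi>
  proof -
    have "rename (f \<circ> g) \<phi> \<in> H \<longleftrightarrow> rename (\<lambda>n. n) \<phi> \<in> H"
      by (rule rename_Eq_cong) (simp add: g)
    then show ?thesis using truth that by (simp add: rename_id)
  qed
  then show ?thesis by blast
qed

end

lemma fvs_ZF: "\<phi> \<in> ZF \<Longrightarrow> fvs \<phi> = {}"
  by (auto simp: ZF_def closures_def extensionality_def foundation_def pairing_def union_def
      powerset_def infinity_def)

text \<open>Free variables of \<Gamma> act as constants, valued by \<open>s\<close>; finiteness of
  their set leaves variables for the witnesses. ZF consists of closed formulae, so its truth at
  \<open>s\<close> carries over to all assignments.\<close>

theorem countable_model_exists:
  assumes "consistent \<Gamma>" "finite (\<Union>(fvs ` \<Gamma>))" and ZF: "ZF \<subseteq> \<Gamma>"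
  shows "\<exists>(E :: nat \<Rightarrow> nat \<Rightarrow> bool) s. models_ZF E \<and> (\<forall>\<phi>\<in>\<Gamma>. sats E s \<phi>)"
proof -
  obtain H where H: "\<Gamma> \<subseteq> H" "henkin H" using henkin_extension assms(1,2) by blast
  then obtain E :: "nat \<Rightarrow> nat \<Rightarrow> bool" and s where E: "\<forall>\<phi>\<in>H. sats E s \<phi>"
    using henkin.ex_model ZF by blast
  have "sats E s' \<phi>" if "\<phi> \<in> ZF" for \<phi> s'
    using that E H(1) ZF sat_cong_fv[of \<phi> s s' E] fvs_ZF by blast
  with E H(1) show ?thesis unfolding models_ZF_def by blast
qed

section \<open>Uniformly definable predicates\<close>

text \<open>The quantifier rules keep the body as a function of the old assignment
  \<open>\<lambda>n. s (Suc n)\<close> and the new value \<open>s 0\<close>, so that they apply by higher-order pattern unification.\<close>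

definition fo :: "nat \<Rightarrow> ((nat \<Rightarrow> nat \<Rightarrow> bool) \<Rightarrow> (nat \<Rightarrow> nat) \<Rightarrow> bool) \<Rightarrow> bool" where
  "fo N R \<longleftrightarrow> (\<exists>\<phi>. fvs \<phi> \<subseteq> {..<N} \<and> (\<forall>E s. sats E s \<phi> \<longleftrightarrow> R E s))"

lemma fo_mem: "i < N \<Longrightarrow> j < N \<Longrightarrow> fo N (\<lambda>E s. E (s i) (s j))"
  unfolding fo_def by (rule exI[of _ "Mem i j"]) auto

lemma fo_eq: "i < N \<Longrightarrow> j < N \<Longrightarrow> fo N (\<lambda>E s. s i = s j)"
  unfolding fo_def by (rule exI[of _ "Eq i j"]) auto

lemma fo_False: "fo N (\<lambda>E s. False)"
  unfolding fo_def by (rule exI[of _ Fls]) auto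

lemma fo_imp:
  assumes "fo N (\<lambda>E s. R E s)" "fo N (\<lambda>E s. R' E s)"
  shows "fo N (\<lambda>E s. R E s \<longrightarrow> R' E s)"
proof -
  obtain \<phi> \<psi> where "fvs \<phi> \<subseteq> {..<N}" "\<forall>E s. sats E s \<phi> \<longleftrightarrow> R E s"
    "fvs \<psi> \<subseteq> {..<N}" "\<forall>E s. sats E s \<psi> \<longleftrightarrow> R' E s" using assms unfolding fo_def by blast
  then show ?thesis unfolding fo_def by (intro exI[of _ "Imp \<phi> \<psi>"]) auto
qed

lemma fo_all:
  assumes "fo (Suc N) (\<lambda>E s. R E (\<lambda>n. s (Suc n)) (s 0))"
  shows "fo N (\<lambda>E s. \<forall>x. R E s x)"
proof -
  obtain \<phi> where \<phi>: "fvs \<phi> \<subseteq> {..<Suc N}" "\<forall>E s. sats E s \<phi> \<longleftrightarrow> R E (\<lambda>n. s (Suc n)) (s 0)"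
    using assms unfolding fo_def by blast
  then show ?thesis unfolding fo_def by (intro exI[of _ "All \<phi>"]) auto
qed

lemma fo_not: "fo N (\<lambda>E s. R E s) \<Longrightarrow> fo N (\<lambda>E s. \<not> R E s)"
  using fo_imp[OF _ fo_False] by simp

lemma fo_and:
  assumes "fo N (\<lambda>E s. R E s)" "fo N (\<lambda>E s. R' E s)"
  shows "fo N (\<lambda>E s. R E s \<and> R' E s)"
  using fo_not[OF fo_imp[OF assms(1) fo_not[OF assms(2)]]] by simp

lemma fo_or:
  assumes "fo N (\<lambda>E s. R E s)" "fo N (\<lambda>E s. R' E s)"
  shows "fo N (\<lambda>E s. R E s \<or> R' E s)"
  using fo_imp[OF fo_not[OF assms(1)] assms(2)] by (simp add: disj_imp)

lemma fo_iff:
  assumes "fo N (\<lambda>E s. R E s)" "fo N (\<lambda>E s. R' E s)"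
  shows "fo N (\<lambda>E s. R E s \<longleftrightarrow> R' E s)"
  using fo_and[OF fo_imp[OF assms] fo_imp[OF assms(2,1)]] by (simp add: iff_conv_conj_imp)

lemma fo_ex:
  assumes "fo (Suc N) (\<lambda>E s. R E (\<lambda>n. s (Suc n)) (s 0))"
  shows "fo N (\<lambda>E s. \<exists>x. R E s x)"
  using fo_not[OF fo_all[OF fo_not[OF assms]]] by simp

lemmas fo_intros = fo_mem fo_eq fo_False fo_imp fo_all fo_not fo_and fo_or fo_iff fo_ex

lemma fo_is_pair: "i < N \<Longrightarrow> j < N \<Longrightarrow> k < N \<Longrightarrow> fo N (\<lambda>E s. is_pair E (s i) (s j) (s k))"
  unfolding is_pair_def is_upair_def by (intro fo_intros) simp_all

lemma fo_po_carrier: "i < N \<Longrightarrow> j < N \<Longrightarrow> fo N (\<lambda>E s. s i \<in> po_carrier E (s j))"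
  unfolding po_carrier_def mem_Collect_eq by (intro fo_intros fo_is_pair) simp_all

lemma fo_po_rel: "i < N \<Longrightarrow> j < N \<Longrightarrow> k < N \<Longrightarrow> fo N (\<lambda>E s. (s i, s j) \<in> po_rel E (s k))"
  unfolding po_rel_def mem_Collect_eq prod.case by (intro fo_intros fo_is_pair) simp_all

text \<open>Unfolds inclusion and bounded quantifiers, so that only shapes covered by
  \<open>fo_intros\<close> remain.\<close>

lemma partial_order_on_iff:
  "partial_order_on A r \<longleftrightarrow>
     (\<forall>x y. (x, y) \<in> r \<longrightarrow> x \<in> A \<and> y \<in> A) \<and> (\<forall>x. x \<in> A \<longrightarrow> (x, x) \<in> r) \<and>
     (\<forall>x y z. (x, y) \<in> r \<longrightarrow> (y, z) \<in> r \<longrightarrow> (x, z) \<in> r) \<and>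
     (\<forall>x y. (x, y) \<in> r \<longrightarrow> (y, x) \<in> r \<longrightarrow> x = y)"
proof -
  have "r \<subseteq> A \<times> A \<longleftrightarrow> (\<forall>x y. (x, y) \<in> r \<longrightarrow> x \<in> A \<and> y \<in> A)" by auto
  then show ?thesis
    unfolding partial_order_on_def preorder_on_def refl_on_def trans_def antisym_def
    by (simp only: Ball_def conj_assoc)
qed

lemma is_po_iff:
  "is_po E P \<longleftrightarrow>
     (\<exists>q r. is_pair E q r P \<and> (\<forall>z. E z r \<longrightarrow> (\<exists>x y. E x q \<and> E y q \<and> is_pair E x y z))) \<and>
     (\<forall>x y. (x, y) \<in> po_rel E P \<longrightarrow> x \<in> po_carrier E P \<and> y \<in> po_carrier E P) \<and>
     (\<forall>x. x \<in> po_carrier E P \<longrightarrow> (x, x) \<in> po_rel E P) \<and>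
     (\<forall>x y z. (x, y) \<in> po_rel E P \<longrightarrow> (y, z) \<in> po_rel E P \<longrightarrow> (x, z) \<in> po_rel E P) \<and>
     (\<forall>x y. (x, y) \<in> po_rel E P \<longrightarrow> (y, x) \<in> po_rel E P \<longrightarrow> x = y) \<and>
     (\<exists>x. x \<in> po_carrier E P)"
  unfolding is_po_def partial_order_on_iff ex_in_conv by (simp only: conj_assoc)

lemma fo_is_po: "i < N \<Longrightarrow> fo N (\<lambda>E s. is_po E (s i))"
  unfolding is_po_iff by (intro fo_intros fo_is_pair fo_po_rel fo_po_carrier) simp_all

lemma is_dense_iff:
  "is_dense E P {x. E x c} \<longleftrightarrow> (\<forall>x. E x c \<longrightarrow> x \<in> po_carrier E P) \<and>
     (\<forall>p. p \<in> po_carrier E P \<longrightarrow> (\<exists>q. E q c \<and> (q, p) \<in> po_rel E P))"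
  unfolding is_dense_def by blast

lemma fo_is_dense: "i < N \<Longrightarrow> j < N \<Longrightarrow> fo N (\<lambda>E s. is_dense E (s i) {x. E x (s j)})"
  unfolding is_dense_iff by (intro fo_intros fo_po_rel fo_po_carrier) simp_all


section \<open>An atomless partial order in a model of ZF\<close>

lemma sats_All_funpow: "(\<And>s. sats E s ((All ^^ n) \<phi>)) \<Longrightarrow> sats E s \<phi>"
proof (induction n arbitrary: s)
  case (Suc n)
  have "sats E s' ((All ^^ n) \<phi>)" for s'
  proof -
    have "sats E (\<lambda>n. s' (Suc n)) ((All ^^ Suc n) \<phi>)" by (rule Suc.prems)
    then have "sats E (case_nat (s' 0) (\<lambda>n. s' (Suc n))) ((All ^^ n) \<phi>)" by simp
    moreover have "case_nat (s' 0) (\<lambda>n. s' (Suc n)) = s'" by (auto split: nat.split)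
    ultimately show ?thesis by simp
  qed
  then show ?case by (rule Suc.IH)
qed simp

lemma closures_nonempty: "\<exists>n. fvs ((All ^^ n) \<phi>) = {}"
proof -
  have "fvs ((All ^^ n) \<phi>) = {m. m + n \<in> fvs \<phi>}" for n
    by (induction n) auto
  moreover obtain k where "\<forall>m\<in>fvs \<phi>. m < k" using finite_fvs finite_nat_set_iff_bounded by blast
  ultimately show ?thesis by (intro exI[of _ k]) force
qed

locale zf_model =
  fixes E :: "nat \<Rightarrow> nat \<Rightarrow> bool"
  assumes ZF: "models_ZF E"
begin

lemma axiom: "\<phi> \<in> ZF \<Longrightarrow> sats E s \<phi>"
  using ZF by (simp add: models_ZF_def)

lemma ext: "(\<And>z. E z x \<longleftrightarrow> E z y) \<Longrightarrow> x = y"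
  using axiom[of extensionality undefined] by (simp add: ZF_def extensionality_def)

lemma found: "E y x \<Longrightarrow> \<exists>y. E y x \<and> \<not> (\<exists>z. E z x \<and> E z y)"
  using axiom[of foundation undefined] by (simp add: ZF_def foundation_def) meson

lemma pair: "\<exists>p. \<forall>z. E z p \<longleftrightarrow> z = x \<or> z = y"
  using axiom[of pairing undefined] by (simp add: ZF_def pairing_def) meson

lemma Union: "\<exists>u. \<forall>z. E z u \<longleftrightarrow> (\<exists>y. E y x \<and> E z y)"
  using axiom[of union undefined] by (simp add: ZF_def union_def) meson

lemma Pow: "\<exists>p. \<forall>z. E z p \<longleftrightarrow> (\<forall>w. E w z \<longrightarrow> E w x)"
  using axiom[of powerset undefined] by (simp add: ZF_def powerset_def) meson

lemma infinity: "\<exists>x. (\<exists>e. E e x) \<and> (\<forall>y. E y x \<longrightarrow> (\<exists>s. E s x \<and> (\<forall>w. E w s \<longleftrightarrow> E w y \<or> w = y)))"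
  using axiom[of infinity undefined] by (simp add: ZF_def infinity_def) meson

lemma sep_env:
  assumes "fo N R"
  shows "\<exists>y. \<forall>z. E z y \<longleftrightarrow> E z x \<and> R E (case_nat z (case_nat x s))"
proof -
  obtain \<phi> where \<phi>: "\<forall>E s. sats E s \<phi> \<longleftrightarrow> R E s" using assms unfolding fo_def by blast
  obtain n where n: "fvs ((All ^^ n) (separation \<phi>)) = {}" using closures_nonempty by blast
  then have "(All ^^ n) (separation \<phi>) \<in> ZF" unfolding ZF_def closures_def by blast
  then have "sats E s (separation \<phi>)" using sats_All_funpow axiom by metis
  moreover have "case_nat z (case_nat y (case_nat x s)) \<circ> case_nat 0 (\<lambda>n. n + 2) = case_nat z (case_nat x s)" for z y x
    by (auto split: nat.split)
  ultimately have "\<forall>x. \<exists>y. \<forall>z. E z y \<longleftrightarrow> E z x \<and> R E (case_nat z (case_nat x s))"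
    unfolding separation_def sat.simps sat_rename by (simp add: \<phi>) meson
  then show ?thesis by blast
qed

lemma sep:
  assumes "fo 4 (\<lambda>E s. Q E (s 0) (s 1) (s 2) (s 3))"
  shows "\<exists>y. \<forall>z. E z y \<longleftrightarrow> E z x \<and> Q E z x a b"
  \<comment> \<open>Index 2 gets \<open>a\<close>; index 3 and all later ones get
    \<open>b\<close>.\<close>
  using sep_env[OF assms, of x "case_nat a (\<lambda>_. b)"] by (simp add: numeral_2_eq_2 numeral_3_eq_3)

end

section \<open>Kuratowski pairs and bounding sets inside the model\<close>

context zf_model
begin

lemma not_self_mem: "\<not> E x x"
proof
  assume "E x x"
  obtain p where p: "\<And>z. E z p \<longleftrightarrow> z = x" using pair[of x x] by blast
  then have "E x p" by simp
  from found[OF this] obtain y where "E y p" "\<not> (\<exists>z. E z p \<and> E z y)" by (elim exE conjE)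
  with p \<open>E x x\<close> show False by metis
qed

lemma ex_is_upair: "\<exists>p. is_upair E a b p"
  unfolding is_upair_def by (rule pair)

lemma ex_is_pair: "\<exists>p. is_pair E a b p"
  unfolding is_pair_def using ex_is_upair by metis

lemma is_upair_iff: "is_upair E a b p \<longleftrightarrow> {x. E x p} = {a, b}"
  unfolding is_upair_def by auto

lemma is_pair_inject: "is_pair E a b p \<Longrightarrow> is_pair E c d p \<Longrightarrow> a = c \<and> b = d"
  unfolding is_pair_def is_upair_iff by (auto simp: doubleton_eq_iff)

lemma is_upair_unique: "is_upair E a b p \<Longrightarrow> is_upair E a b q \<Longrightarrow> p = q"
  unfolding is_upair_def by (rule ext) simp

lemma is_pair_unique: "is_pair E a b p \<Longrightarrow> is_pair E a b q \<Longrightarrow> p = q"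
  unfolding is_pair_def using is_upair_unique by metis

lemma binary_union: "\<exists>u. \<forall>z. E z u \<longleftrightarrow> E z x \<or> E z y"
proof -
  obtain p where p: "\<And>z. E z p \<longleftrightarrow> z = x \<or> z = y" using pair by blast
  obtain u where "\<And>z. E z u \<longleftrightarrow> (\<exists>y. E y p \<and> E z y)" using Union by blast
  with p have "\<forall>z. E z u \<longleftrightarrow> E z x \<or> E z y" by metis
  then show ?thesis by blast
qed

text \<open>A Kuratowski pair lies in the double power set of the union of \<open>A\<close> and
  \<open>B\<close>; this supplies the bound that separation requires for forming sets of
  pairs.\<close>

lemma pairs_bounded: "\<exists>C. \<forall>a b p. E a A \<longrightarrow> E b B \<longrightarrow> is_pair E a b p \<longrightarrow> E p C"
proof -
  obtain U where U: "\<And>z. E z U \<longleftrightarrow> E z A \<or> E z B" using binary_union by blast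
  obtain V where V: "\<And>z. E z V \<longleftrightarrow> (\<forall>w. E w z \<longrightarrow> E w U)" using Pow by blast
  obtain C where C: "\<And>z. E z C \<longleftrightarrow> (\<forall>w. E w z \<longrightarrow> E w V)" using Pow by blast
  have "E p C" if "E a A" "E b B" "is_pair E a b p" for a b p
  proof -
    obtain u v where uv: "is_upair E a a u" "is_upair E a b v" "is_upair E u v p"
      using \<open>is_pair E a b p\<close> unfolding is_pair_def by blast
    have "E u V" "E v V" using uv(1,2) that(1,2) U V by (auto simp: is_upair_def)
    then show ?thesis using uv(3) C by (auto simp: is_upair_def)
  qed
  then show ?thesis by blast
qed

lemma po_carrier_pair: "is_pair E q r P \<Longrightarrow> po_carrier E P = {x. E x q}"
  unfolding po_carrier_def using is_pair_inject by blast

lemma po_rel_pair: "is_pair E q r P \<Longrightarrow> po_rel E P = {(x, y). \<exists>z. is_pair E x y z \<and> E z r}"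
  unfolding po_rel_def using is_pair_inject by blast

end

text \<open>A condition is a pair \<open>(n, a)\<close> with \<open>a \<subseteq> n\<close> and \<open>n\<close> in a fixed inductive set, and \<open>(n, a)\<close>
  extends \<open>(m, b)\<close> if \<open>m \<subseteq> n\<close> and \<open>b = a \<inter> m\<close>. This is a variant of Cohen forcing for which no
  natural numbers have to be developed in the model.\<close>

definition cond :: "(nat \<Rightarrow> nat \<Rightarrow> bool) \<Rightarrow> nat \<Rightarrow> nat \<Rightarrow> bool" where
  "cond E X x \<longleftrightarrow> (\<exists>n a. is_pair E n a x \<and> E n X \<and> (\<forall>z. E z a \<longrightarrow> E z n))"

definition extends :: "(nat \<Rightarrow> nat \<Rightarrow> bool) \<Rightarrow> nat \<Rightarrow> nat \<Rightarrow> bool" where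
  "extends E x y \<longleftrightarrow> (\<exists>n a m b. is_pair E n a x \<and> is_pair E m b y \<and>
     (\<forall>z. E z m \<longrightarrow> E z n) \<and> (\<forall>z. E z b \<longleftrightarrow> E z a \<and> E z m))"

lemma fo_cond: "i < N \<Longrightarrow> j < N \<Longrightarrow> fo N (\<lambda>E s. cond E (s i) (s j))"
  unfolding cond_def by (intro fo_intros fo_is_pair) simp_all

lemma fo_extends: "i < N \<Longrightarrow> j < N \<Longrightarrow> fo N (\<lambda>E s. extends E (s i) (s j))"
  unfolding extends_def by (intro fo_intros fo_is_pair) simp_all

section \<open>The Cohen-like order of conditions\<close>

context zf_model
begin

lemma extends_pair:
  assumes "is_pair E n a x" "is_pair E m b y"
  shows "extends E x y \<longleftrightarrow> (\<forall>z. E z m \<longrightarrow> E z n) \<and> (\<forall>z. E z b \<longleftrightarrow> E z a \<and> E z m)"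
proof
  assume "extends E x y"
  then obtain n' a' m' b' where *: "is_pair E n' a' x" "is_pair E m' b' y"
    "(\<forall>z. E z m' \<longrightarrow> E z n') \<and> (\<forall>z. E z b' \<longleftrightarrow> E z a' \<and> E z m')" unfolding extends_def by blast
  have "n' = n" "a' = a" "m' = m" "b' = b"
    using is_pair_inject[OF *(1) assms(1)] is_pair_inject[OF *(2) assms(2)] by simp_all
  with * show "(\<forall>z. E z m \<longrightarrow> E z n) \<and> (\<forall>z. E z b \<longleftrightarrow> E z a \<and> E z m)" by simp
next
  assume "(\<forall>z. E z m \<longrightarrow> E z n) \<and> (\<forall>z. E z b \<longleftrightarrow> E z a \<and> E z m)"
  then show "extends E x y" unfolding extends_def
    by (intro exI[of _ n] exI[of _ a] exI[of _ m] exI[of _ b]) (simp add: assms)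
qed

lemma extends_refl: "cond E X x \<Longrightarrow> extends E x x"
proof -
  assume "cond E X x"
  then obtain n a where x: "is_pair E n a x" "\<forall>z. E z a \<longrightarrow> E z n" unfolding cond_def by blast
  show ?thesis unfolding extends_pair[OF x(1) x(1)] using x(2) by auto
qed

lemma extends_trans: "extends E x y \<Longrightarrow> extends E y z \<Longrightarrow> extends E x z"
proof -
  assume xy: "extends E x y" and yz: "extends E y z"
  obtain n a m b where p: "is_pair E n a x" "is_pair E m b y" using xy unfolding extends_def by blast
  obtain k c where q: "is_pair E k c z" using yz unfolding extends_def by blast
  show "extends E x z"
    using xy yz unfolding extends_pair[OF p] extends_pair[OF p(2) q] extends_pair[OF p(1) q] by blast
qed

lemma extends_antisym:
  assumes "cond E X x" "cond E X y" "extends E x y" "extends E y x"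
  shows "x = y"
proof -
  obtain n a where x: "is_pair E n a x" "\<forall>z. E z a \<longrightarrow> E z n" using assms(1) unfolding cond_def by blast
  obtain m b where y: "is_pair E m b y" "\<forall>z. E z b \<longrightarrow> E z m" using assms(2) unfolding cond_def by blast
  have *: "E z n \<longleftrightarrow> E z m" "E z a \<longleftrightarrow> E z b" for z
    using assms(3,4) x(2) y(2) unfolding extends_pair[OF x(1) y(1)] extends_pair[OF y(1) x(1)]
    by meson+
  have "n = m" "a = b" by (rule ext, rule *)+
  with x y show ?thesis using is_pair_unique by simp
qed

text \<open>With \<open>p\<close> the pair of \<open>n\<close> and \<open>a\<close>, and
  \<open>n'\<close> the successor of \<open>n\<close>, the two extensions decide differently whether
  \<open>n\<close> belongs to the second component. The one containing \<open>n\<close> still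
  extends \<open>p\<close> because \<open>n\<close> is not in \<open>n\<close>. A common extension
  would force \<open>n\<close> into \<open>a\<close> and hence into itself.\<close>

lemma split_cond:
  assumes succ: "\<And>y. E y X \<Longrightarrow> \<exists>s. E s X \<and> (\<forall>w. E w s \<longleftrightarrow> E w y \<or> w = y)" and p: "cond E X p"
  shows "\<exists>q r. cond E X q \<and> cond E X r \<and> extends E q p \<and> extends E r p \<and>
    \<not> (\<exists>w. extends E w q \<and> extends E w r)"
proof -
  obtain n a where n: "is_pair E n a p" "E n X" "\<forall>z. E z a \<longrightarrow> E z n" using p unfolding cond_def by blast
  obtain n' where n': "E n' X" "\<And>w. E w n' \<longleftrightarrow> E w n \<or> w = n" using succ n(2) by blast
  obtain i where i: "\<And>w. E w i \<longleftrightarrow> w = n" using pair[of n n] by blast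
  obtain a' where a': "\<And>w. E w a' \<longleftrightarrow> E w a \<or> w = n" using binary_union[of a i] i by auto
  obtain q where q: "is_pair E n' a q" using ex_is_pair by blast
  obtain r where r: "is_pair E n' a' r" using ex_is_pair by blast
  have "cond E X q" unfolding cond_def
    by (intro exI[of _ n'] exI[of _ a]) (simp add: q n' n(3))
  moreover have "cond E X r" unfolding cond_def
    by (intro exI[of _ n'] exI[of _ a']) (auto simp: r n' n(3) a')
  moreover have "extends E q p" unfolding extends_pair[OF q n(1)] using n' n(3) by auto
  moreover have "extends E r p" unfolding extends_pair[OF r n(1)]
    using n' n(3) a' not_self_mem by auto
  moreover have False if w: "extends E w q" "extends E w r" for w
  proof -
    obtain k c where k: "is_pair E k c w" using w(1) unfolding extends_def by blast
    have "E n a" using w n'(2) a' unfolding extends_pair[OF k q] extends_pair[OF k r] by metis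
    with n(3) not_self_mem show False by blast
  qed
  ultimately show ?thesis by blast
qed

lemma ex_set_of_conds: "\<exists>Q. \<forall>x. E x Q \<longleftrightarrow> cond E X x"
proof -
  obtain U where U: "\<And>z. E z U \<longleftrightarrow> (\<exists>y. E y X \<and> E z y)" using Union by blast
  obtain V where V: "\<And>z. E z V \<longleftrightarrow> (\<forall>w. E w z \<longrightarrow> E w U)" using Pow by blast
  obtain C where C: "\<And>a b p. E a X \<Longrightarrow> E b V \<Longrightarrow> is_pair E a b p \<Longrightarrow> E p C"
    using pairs_bounded[of X V] by blast
  have "fo 4 (\<lambda>E s. cond E (s 2) (s 0))" by (rule fo_cond) simp_all
  from sep[of "\<lambda>E z x a b. cond E a z", OF this]
  obtain Q where Q: "\<And>z. E z Q \<longleftrightarrow> E z C \<and> cond E X z" by blast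
  \<comment> \<open>The second component of a condition is a subset of an element of
    \<open>X\<close>, hence of the union \<open>U\<close>.\<close>
  have "E x C" if "cond E X x" for x
    using that U V C unfolding cond_def by blast
  with Q show ?thesis by blast
qed

lemma ex_set_of_extensions: "\<exists>r. \<forall>z. E z r \<longleftrightarrow> (\<exists>x y. E x Q \<and> E y Q \<and> extends E x y \<and> is_pair E x y z)"
proof -
  obtain C where C: "\<And>a b p. E a Q \<Longrightarrow> E b Q \<Longrightarrow> is_pair E a b p \<Longrightarrow> E p C"
    using pairs_bounded[of Q Q] by blast
  have "fo 4 (\<lambda>E s. \<exists>x y. E x (s 2) \<and> E y (s 2) \<and> extends E x y \<and> is_pair E x y (s 0))"
    by (intro fo_intros fo_extends fo_is_pair) simp_all
  from sep[of "\<lambda>E z x a b. \<exists>x y. E x a \<and> E y a \<and> extends E x y \<and> is_pair E x y z", OF this]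
  obtain r where "\<And>z. E z r \<longleftrightarrow> E z C \<and> (\<exists>x y. E x Q \<and> E y Q \<and> extends E x y \<and> is_pair E x y z)"
    by blast
  with C show ?thesis by blast
qed

lemma ex_atomless_po:
  "\<exists>P. is_po E P \<and> (\<forall>p\<in>po_carrier E P. \<exists>q r. (q, p) \<in> po_rel E P \<and> (r, p) \<in> po_rel E P \<and>
     \<not> (\<exists>w. (w, q) \<in> po_rel E P \<and> (w, r) \<in> po_rel E P))"
proof -
  obtain X e where X: "E e X" and succ: "\<And>y. E y X \<Longrightarrow> \<exists>s. E s X \<and> (\<forall>w. E w s \<longleftrightarrow> E w y \<or> w = y)"
    using infinity by blast
  obtain Q where Q: "\<And>x. E x Q \<longleftrightarrow> cond E X x" using ex_set_of_conds by blast
  obtain r where r: "\<And>z. E z r \<longleftrightarrow> (\<exists>x y. E x Q \<and> E y Q \<and> extends E x y \<and> is_pair E x y z)"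
    using ex_set_of_extensions by blast
  obtain P where P: "is_pair E Q r P" using ex_is_pair by blast
  have carrier: "po_carrier E P = {x. cond E X x}" using po_carrier_pair[OF P] Q by simp
  have rel: "(x, y) \<in> po_rel E P \<longleftrightarrow> cond E X x \<and> cond E X y \<and> extends E x y" for x y
  proof -
    have "(x, y) \<in> po_rel E P \<longleftrightarrow> (\<exists>z. is_pair E x y z \<and> E z r)" using po_rel_pair[OF P] by simp
    also have "\<dots> \<longleftrightarrow> E x Q \<and> E y Q \<and> extends E x y"
      unfolding r using ex_is_pair is_pair_inject by metis
    finally show ?thesis by (simp add: Q)
  qed
  \<comment> \<open>Nonemptiness: any \<open>e\<close> in \<open>X\<close> is a subset of itself and
    so yields a condition.\<close>
  obtain p where p: "is_pair E e e p" using ex_is_pair by blast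
  then have "cond E X p" unfolding cond_def using X by blast
  moreover have "\<exists>x y. E x Q \<and> E y Q \<and> is_pair E x y z" if "E z r" for z
    using that r by blast
  ultimately have "is_po E P"
    unfolding is_po_iff carrier mem_Collect_eq rel
    using P extends_refl extends_trans extends_antisym by (intro conjI) blast+
  moreover have "\<exists>q r. (q, p) \<in> po_rel E P \<and> (r, p) \<in> po_rel E P \<and>
     \<not> (\<exists>w. (w, q) \<in> po_rel E P \<and> (w, r) \<in> po_rel E P)" if "p \<in> po_carrier E P" for p
    using that split_cond[of X p] succ unfolding carrier mem_Collect_eq rel by blast
  ultimately show ?thesis by blast
qed

end

section \<open>A dense set avoiding all linked definable sets\<close>

text \<open>All variables except 0 take the value \<open>P\<close>, so every formula counts as a
  definition with \<open>P\<close> as its only parameter, whatever its free variables.\<close>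

definition defset :: "nat fm \<Rightarrow> (nat \<Rightarrow> nat \<Rightarrow> bool) \<Rightarrow> nat \<Rightarrow> nat set" where
  "defset \<psi> E P = {x. sats E (case_nat x (\<lambda>_. P)) \<psi>}"

text \<open>The common lower bound may lie outside \<open>X\<close>. Plain quantifiers are used so
  that \<open>fo_intros\<close> applies.\<close>

definition linked :: "(nat \<Rightarrow> nat \<Rightarrow> bool) \<Rightarrow> nat \<Rightarrow> nat set \<Rightarrow> bool" where
  "linked E P X \<longleftrightarrow>
     (\<forall>p. p \<in> X \<longrightarrow> (\<forall>q. q \<in> X \<longrightarrow> (\<exists>r. (r, p) \<in> po_rel E P \<and> (r, q) \<in> po_rel E P)))"

lemma fvs_rename: "fvs (rename r \<phi>) \<subseteq> r ` fvs \<phi>"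
proof (induction \<phi> arbitrary: r)
  case (Imp \<phi> \<psi>)
  then show ?case by (simp add: image_Un le_supI1 le_supI2)
next
  case (All \<phi>)
  show ?case
  proof
    fix n assume "n \<in> fvs (rename r (All \<phi>))"
    then have "Suc n \<in> fvs (rename (case_nat 0 (\<lambda>n. Suc (r n))) \<phi>)" by simp
    then obtain m where "m \<in> fvs \<phi>" "Suc n = case_nat 0 (\<lambda>n. Suc (r n)) m" using All.IH by blast
    then show "n \<in> r ` fvs (All \<phi>)" by (cases m) auto
  qed
qed auto

lemma fo_defset: "i < N \<Longrightarrow> j < N \<Longrightarrow> fo N (\<lambda>E s. s i \<in> defset \<psi> E (s j))"
proof -
  assume ij: "i < N" "j < N"
  have "fvs (rename (case_nat i (\<lambda>_. j)) \<psi>) \<subseteq> {..<N}"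
    using fvs_rename[of "case_nat i (\<lambda>_. j)" \<psi>] ij by (auto split: nat.splits)
  moreover have "s \<circ> case_nat i (\<lambda>_. j) = case_nat (s i) (\<lambda>_. s j)" for s :: "nat \<Rightarrow> nat"
    by (auto split: nat.split)
  ultimately show ?thesis
    unfolding fo_def defset_def mem_Collect_eq
    by (intro exI[of _ "rename (case_nat i (\<lambda>_. j)) \<psi>"]) (simp add: sat_rename)
qed

text \<open>Below \<open>p\<close> choose incompatible \<open>q\<close> and \<open>r\<close>, and
  below these \<open>q'\<close> and \<open>r'\<close> in \<open>C\<close>. A common extension of
  \<open>q'\<close> and \<open>r'\<close> would lie below both \<open>q\<close> and
  \<open>r\<close>, so at most one of them is in \<open>X\<close>, and the other survives the
  removal.\<close>

lemma dense_Diff_linked: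
  assumes dense: "is_dense E P C" and po: "is_po E P"
    and split: "\<And>p. p \<in> po_carrier E P \<Longrightarrow> \<exists>q r. (q, p) \<in> po_rel E P \<and> (r, p) \<in> po_rel E P \<and>
      \<not> (\<exists>w. (w, q) \<in> po_rel E P \<and> (w, r) \<in> po_rel E P)"
    and X: "linked E P X"
  shows "is_dense E P (C - X)"
  unfolding is_dense_def
proof (intro conjI ballI)
  show "C - X \<subseteq> po_carrier E P" using dense by (auto simp: is_dense_def)
  have trans: "(x, z) \<in> po_rel E P" if "(x, y) \<in> po_rel E P" "(y, z) \<in> po_rel E P" for x y z
    using po that unfolding is_po_iff by blast
  fix p assume "p \<in> po_carrier E P"
  with split obtain q r where qr: "(q, p) \<in> po_rel E P" "(r, p) \<in> po_rel E P"
    "\<not> (\<exists>w. (w, q) \<in> po_rel E P \<and> (w, r) \<in> po_rel E P)" by blast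
  then have "q \<in> po_carrier E P" "r \<in> po_carrier E P" using po unfolding is_po_iff by blast+
  then obtain q' r' where q': "q' \<in> C" "(q', q) \<in> po_rel E P" and r': "r' \<in> C" "(r', r) \<in> po_rel E P"
    using dense unfolding is_dense_def by blast
  have "\<not> (q' \<in> X \<and> r' \<in> X)" using X qr(3) q'(2) r'(2) trans unfolding linked_def by blast
  then show "\<exists>q\<in>C - X. (q, p) \<in> po_rel E P" using q' r' qr trans by blast
qed

text \<open>Each removal is one instance of separation with parameter \<open>P\<close>; finiteness
  of \<Psi> allows iterating it outside the model.\<close>

lemma (in zf_model) ex_dense_avoiding_finite:
  assumes "finite \<Psi>"
  shows "\<exists>P c. is_po E P \<and> is_dense E P {x. E x c} \<and>
    (\<forall>\<psi>\<in>\<Psi>. linked E P (defset \<psi> E P) \<longrightarrow> (\<forall>x. E x c \<longrightarrow> x \<notin> defset \<psi> E P))"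
proof -
  obtain P where po: "is_po E P" and split: "\<And>p. p \<in> po_carrier E P \<Longrightarrow>
      \<exists>q r. (q, p) \<in> po_rel E P \<and> (r, p) \<in> po_rel E P \<and>
      \<not> (\<exists>w. (w, q) \<in> po_rel E P \<and> (w, r) \<in> po_rel E P)"
    using ex_atomless_po by blast
  have "\<exists>c. is_dense E P {x. E x c} \<and>
    (\<forall>\<psi>\<in>\<Psi>. linked E P (defset \<psi> E P) \<longrightarrow> (\<forall>x. E x c \<longrightarrow> x \<notin> defset \<psi> E P))"
    using assms
  proof (induction \<Psi> rule: finite_induct)
    case empty
    \<comment> \<open>The starting point is the whole carrier \<open>q\<close>, dense in itself by
      reflexivity.\<close>
    obtain q r where q: "is_pair E q r P" using po unfolding is_po_def by blast
    have "is_dense E P {x. E x q}"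
      using po po_carrier_pair[OF q] unfolding is_dense_def is_po_iff by blast
    then show ?case by blast
  next
    case (insert \<psi> \<Psi>)
    then obtain c where c: "is_dense E P {x. E x c}"
      "\<And>\<psi> x. \<psi> \<in> \<Psi> \<Longrightarrow> linked E P (defset \<psi> E P) \<Longrightarrow> E x c \<Longrightarrow> x \<notin> defset \<psi> E P" by blast
    show ?case
    proof (cases "linked E P (defset \<psi> E P)")
      case True
      have "fo 4 (\<lambda>E s. \<not> s 0 \<in> defset \<psi> E (s 2))" by (intro fo_not fo_defset) simp_all
      from sep[of "\<lambda>E z x a b. \<not> z \<in> defset \<psi> E a", OF this]
      obtain d where d: "\<And>z. E z d \<longleftrightarrow> E z c \<and> \<not> z \<in> defset \<psi> E P" by blast
      have "is_dense E P ({x. E x c} - defset \<psi> E P)"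
        using c(1) po split True by (rule dense_Diff_linked)
      moreover have "{x. E x c} - defset \<psi> E P = {x. E x d}" using d by auto
      ultimately have "is_dense E P {x. E x d}" by simp
      moreover have "x \<notin> defset \<psi>' E P" if "\<psi>' \<in> insert \<psi> \<Psi>" "linked E P (defset \<psi>' E P)" "E x d" for \<psi>' x
        using that c(2) d by blast
      ultimately show ?thesis by blast
    next
      case False
      with c show ?thesis by blast
    qed
  qed
  with po show ?thesis by blast
qed

text \<open>Compactness, with variables 0 and 1 as constants for \<open>P\<close> and
  \<open>c\<close>. A finite part of the theory involves the requirements of finitely many \<psi>
  only, and these can be met in any model of ZF.\<close>

theorem ex_model_with_dense_set:
  assumes "consistent ZF"
  shows "\<exists>(E :: nat \<Rightarrow> nat \<Rightarrow> bool) P c. models_ZF E \<and> is_po E P \<and> is_dense E P {x. E x c} \<and>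
    (\<forall>\<psi>. linked E P (defset \<psi> E P) \<longrightarrow> (\<forall>x. E x c \<longrightarrow> x \<notin> defset \<psi> E P))"
proof -
  have "fo 2 (\<lambda>E s. is_po E (s 0) \<and> is_dense E (s 0) {x. E x (s 1)})"
    by (intro fo_and fo_is_po fo_is_dense) simp_all
  then obtain \<beta> where \<beta>: "fvs \<beta> \<subseteq> {..<2}"
    "\<forall>(E :: nat \<Rightarrow> nat \<Rightarrow> bool) s. sats E s \<beta> \<longleftrightarrow> is_po E (s 0) \<and> is_dense E (s 0) {x. E x (s 1)}"
    unfolding fo_def by (elim exE conjE) (rule that)
  have "fo 2 (\<lambda>E s. linked E (s 0) (defset \<psi> E (s 0)) \<longrightarrow>
      (\<forall>x. E x (s 1) \<longrightarrow> x \<notin> defset \<psi> E (s 0)))" for \<psi>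
    unfolding linked_def by (intro fo_intros fo_defset fo_po_rel) simp_all
  then have "\<forall>\<psi>. \<exists>\<alpha>. fvs \<alpha> \<subseteq> {..<2} \<and> (\<forall>(E :: nat \<Rightarrow> nat \<Rightarrow> bool) s. sats E s \<alpha> \<longleftrightarrow>
      (linked E (s 0) (defset \<psi> E (s 0)) \<longrightarrow> (\<forall>x. E x (s 1) \<longrightarrow> x \<notin> defset \<psi> E (s 0))))"
    unfolding fo_def by (rule allI)
  from choice[OF this] obtain \<alpha> where "\<forall>\<psi>. fvs (\<alpha> \<psi>) \<subseteq> {..<2} \<and> (\<forall>(E :: nat \<Rightarrow> nat \<Rightarrow> bool) s. sats E s (\<alpha> \<psi>) \<longleftrightarrow>
      (linked E (s 0) (defset \<psi> E (s 0)) \<longrightarrow> (\<forall>x. E x (s 1) \<longrightarrow> x \<notin> defset \<psi> E (s 0))))" ..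
  then have \<alpha>: "\<And>\<psi>. fvs (\<alpha> \<psi>) \<subseteq> {..<2}" "\<And>\<psi>. \<forall>(E :: nat \<Rightarrow> nat \<Rightarrow> bool) s. sats E s (\<alpha> \<psi>) \<longleftrightarrow>
      (linked E (s 0) (defset \<psi> E (s 0)) \<longrightarrow> (\<forall>x. E x (s 1) \<longrightarrow> x \<notin> defset \<psi> E (s 0)))"
    by simp_all
  let ?\<Gamma> = "ZF \<union> insert \<beta> (range \<alpha>)"
  have "finite (\<Union>(fvs ` ZF))" by (simp add: fvs_ZF)
  then obtain E\<^sub>0 :: "nat \<Rightarrow> nat \<Rightarrow> bool" where "models_ZF E\<^sub>0"
    using countable_model_exists[OF assms] by blast
  then interpret zf_model E\<^sub>0 by (rule zf_model.intro)
  have "consistent ?\<Gamma>"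
  proof (rule consistentI_finite_sat)
    fix \<Delta> assume \<Delta>: "finite \<Delta>" "\<Delta> \<subseteq> ?\<Gamma>"
    then have "finite (\<Delta> \<inter> range \<alpha>)" by simp
    then obtain \<Psi> where \<Psi>: "finite \<Psi>" "\<Delta> \<inter> range \<alpha> = \<alpha> ` \<Psi>"
      by (metis Int_lower2 finite_subset_image)
    obtain P c where Pc: "is_po E\<^sub>0 P" "is_dense E\<^sub>0 P {x. E\<^sub>0 x c}"
      "\<forall>\<psi>\<in>\<Psi>. linked E\<^sub>0 P (defset \<psi> E\<^sub>0 P) \<longrightarrow> (\<forall>x. E\<^sub>0 x c \<longrightarrow> x \<notin> defset \<psi> E\<^sub>0 P)"
      using ex_dense_avoiding_finite[OF \<Psi>(1)] by (elim exE conjE) (rule that)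
    let ?s = "case_nat P (\<lambda>_. c)"
    have "sats E\<^sub>0 ?s \<gamma>" if "\<gamma> \<in> \<Delta>" for \<gamma>
    proof -
      have "\<gamma> \<in> ZF \<union> insert \<beta> (\<Delta> \<inter> range \<alpha>)" using that \<Delta>(2) by auto
      then consider "\<gamma> \<in> ZF" | "\<gamma> = \<beta>" | \<psi> where "\<psi> \<in> \<Psi>" "\<gamma> = \<alpha> \<psi>"
        unfolding \<Psi>(2) by (elim UnE insertE imageE)
      then show ?thesis
      proof cases
        case 1
        then show ?thesis by (rule axiom)
      next
        case 2
        then show ?thesis using Pc by (simp add: \<beta>(2))
      next
        case 3
        then show ?thesis using Pc(3) by (simp add: \<alpha>(2))
      qed
    qed
    then show "\<exists>(E :: nat \<Rightarrow> nat \<Rightarrow> bool) s. \<forall>\<gamma>\<in>\<Delta>. sats E s \<gamma>" by blast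
  qed
  moreover have "finite (\<Union>(fvs ` ?\<Gamma>))"
  proof (rule finite_subset)
    show "\<Union>(fvs ` ?\<Gamma>) \<subseteq> {..<2}" using \<alpha>(1) \<beta>(1) by (force simp: fvs_ZF)
  qed simp
  ultimately obtain E :: "nat \<Rightarrow> nat \<Rightarrow> bool" and s where "models_ZF E" and E: "\<And>\<phi>. \<phi> \<in> ?\<Gamma> \<Longrightarrow> sats E s \<phi>"
    using countable_model_exists[of ?\<Gamma>] by blast
  moreover have "sats E s \<beta>" "sats E s (\<alpha> \<psi>)" for \<psi> using E by blast+
  ultimately show ?thesis
    by (intro exI[of _ E] exI[of _ "s 0"] exI[of _ "s 1"]) (simp add: \<alpha>(2) \<beta>(2))
qed

section \<open>Oracle computations\<close>

lemma step_cong: "oracle_tape A j = oracle_tape B j \<Longrightarrow> step \<Phi> A (q, w, i, j) = step \<Phi> B (q, w, i, j)"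
  by simp

text \<open>The use principle: each step scans a single oracle cell.\<close>

lemma steps_use:
  assumes "(\<lambda>c c'. step \<Phi> A c = Some c')\<^sup>*\<^sup>* c d"
  shows "\<exists>N. \<forall>B. (\<forall>k<N. k \<in> A \<longleftrightarrow> k \<in> B) \<longrightarrow> (\<lambda>c c'. step \<Phi> B c = Some c')\<^sup>*\<^sup>* c d"
  using assms
proof (induction rule: rtranclp_induct)
  case (step d e)
  then obtain N where N: "\<And>B. (\<forall>k<N. k \<in> A \<longleftrightarrow> k \<in> B) \<Longrightarrow> (\<lambda>c c'. step \<Phi> B c = Some c')\<^sup>*\<^sup>* c d"
    by blast
  obtain q w i j where d: "d = (q, w, i, j)" by (cases d)
  \<comment> \<open>\<open>Suc\<close> puts the scanned cell \<open>j\<close> below the bound.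
    Negative cells are blank for every oracle, so the truncation by \<open>nat\<close> is
    harmless.\<close>
  have "(\<lambda>c c'. step \<Phi> B c = Some c')\<^sup>*\<^sup>* c e" if B: "\<forall>k<max N (Suc (nat j)). k \<in> A \<longleftrightarrow> k \<in> B" for B
  proof -
    have t: "oracle_tape A j = oracle_tape B j" using B by (simp add: oracle_tape_def)
    have "step \<Phi> B d = Some e"
      using step.hyps(2) step_cong[OF t, of \<Phi> q w i] unfolding d by (simp only:)
    moreover have "(\<lambda>c c'. step \<Phi> B c = Some c')\<^sup>*\<^sup>* c d" using B by (intro N) simp
    ultimately show ?thesis by (simp add: rtranclp.rtrancl_into_rtrancl)
  qed
  then show ?case by blast
qed simp

lemma computes_value_use:
  assumes "computes_value \<Phi> A n m"
  shows "\<exists>N. \<forall>B. (\<forall>k<N. k \<in> A \<longleftrightarrow> k \<in> B) \<longrightarrow> computes_value \<Phi> B n m"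
proof -
  obtain q w i j where c: "(\<lambda>c c'. step \<Phi> A c = Some c')\<^sup>*\<^sup>* (initial n) (q, w, i, j)"
    "step \<Phi> A (q, w, i, j) = None" "m = card {k. w k = 1}"
    using assms unfolding computes_value_def by blast
  obtain N where N: "\<And>B. (\<forall>k<N. k \<in> A \<longleftrightarrow> k \<in> B) \<Longrightarrow>
      (\<lambda>c c'. step \<Phi> B c = Some c')\<^sup>*\<^sup>* (initial n) (q, w, i, j)"
    using steps_use[OF c(1)] by blast
  \<comment> \<open>Halting depends on the oracle as well: the cell scanned in the final
    configuration must agree too.\<close>
  have "computes_value \<Phi> B n m" if B: "\<forall>k<max N (Suc (nat j)). k \<in> A \<longleftrightarrow> k \<in> B" for B
  proof -
    have t: "oracle_tape A j = oracle_tape B j" using B by (simp add: oracle_tape_def)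
    have "step \<Phi> B (q, w, i, j) = None"
      using c(2) step_cong[OF t, of \<Phi> q w i] by (simp only:)
    moreover have "(\<lambda>c c'. step \<Phi> B c = Some c')\<^sup>*\<^sup>* (initial n) (q, w, i, j)" using B by (intro N) simp
    ultimately show ?thesis using c(3) unfolding computes_value_def by blast
  qed
  then show ?thesis by blast
qed

lemma halting_unique:
  assumes "(\<lambda>c c'. f c = Some c')\<^sup>*\<^sup>* c d" "(\<lambda>c c'. f c = Some c')\<^sup>*\<^sup>* c e" "f d = None" "f e = None"
  shows "d = e"
  using assms
proof (induction rule: converse_rtranclp_induct)
  case base
  from base(1,2) show ?case by (cases rule: converse_rtranclpE) simp_all
next
  case (step c c')
  from step.prems(1) have "(\<lambda>c c'. f c = Some c')\<^sup>*\<^sup>* c' e"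
    by (cases rule: converse_rtranclpE) (use step.hyps(1) step.prems(3) in auto)
  with step show ?case by blast
qed

lemma computes_value_unique: "computes_value \<Phi> A n m \<Longrightarrow> computes_value \<Phi> A n m' \<Longrightarrow> m = m'"
  unfolding computes_value_def
  by (elim exE conjE) (drule halting_unique, assumption+, simp)


section \<open>Finite fragments of the elementary diagram\<close>

lemma code_dterm_inject: "code_dterm t = code_dterm u \<Longrightarrow> t = u"
  by (cases t; cases u) (simp_all only: code_dterm.simps list_encode_eq, simp_all)

lemma code_fm_inject: "code_fm \<phi> = code_fm \<psi> \<Longrightarrow> \<phi> = \<psi>"
proof (induction \<phi> arbitrary: \<psi>)
  case (Mem t u)
  then show ?case
    by (cases \<psi>) (simp_all only: code_fm.simps list_encode_eq, auto dest: code_dterm_inject)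
next
  case (Eq t u)
  then show ?case
    by (cases \<psi>) (simp_all only: code_fm.simps list_encode_eq, auto dest: code_dterm_inject)
next
  case Fls
  then show ?case
    by (cases \<psi>) (simp_all only: code_fm.simps list_encode_eq, auto)
next
  case (Imp \<phi>1 \<phi>2)
  from Imp.prems show ?case
    by (cases \<psi>) (simp_all only: code_fm.simps list_encode_eq, auto dest: Imp.IH)
next
  case (All \<phi>)
  from All.prems show ?case
    by (cases \<psi>) (simp_all only: code_fm.simps list_encode_eq, auto dest: All.IH)
qed

section \<open>Names occurring in a sentence are bounded by its code\<close>

lemma le_list_encode: "x \<in> set xs \<Longrightarrow> x \<le> list_encode xs"
proof (induction xs)
  case (Cons y ys)
  then show ?case
    using le_prod_encode_1[of y "list_encode ys"] le_prod_encode_2[of "list_encode ys" y] by auto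
qed simp

primrec tparams :: "dterm \<Rightarrow> nat set" where
  "tparams (Var n) = {}"
| "tparams (Par a) = {a}"
| "tparams PO = {}"

primrec params :: "dterm fm \<Rightarrow> nat set" where
  "params (Mem t u) = tparams t \<union> tparams u"
| "params (Eq t u) = tparams t \<union> tparams u"
| "params Fls = {}"
| "params (Imp \<phi> \<psi>) = params \<phi> \<union> params \<psi>"
| "params (All \<phi>) = params \<phi>"

lemma tparams_le: "a \<in> tparams t \<Longrightarrow> a \<le> code_dterm t"
  by (cases t) (simp_all only: tparams.simps code_dterm.simps, simp_all add: le_list_encode del: list_encode.simps)

text \<open>The code of a name dominates its number, and codes dominate the codes of their parts.
  Hence sentences with codes below \<open>N\<close> mention only elements below
  \<open>N\<close>.\<close>

lemma params_le: "a \<in> params \<phi> \<Longrightarrow> a \<le> code_fm \<phi>"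
proof (induction \<phi>)
  case (Mem t u)
  have "code_dterm t \<le> code_fm (Mem t u)" "code_dterm u \<le> code_fm (Mem t u)"
    unfolding code_fm.simps by (rule le_list_encode, simp)+
  with Mem show ?case by (auto dest: tparams_le simp del: code_fm.simps)
next
  case (Eq t u)
  have "code_dterm t \<le> code_fm (Eq t u)" "code_dterm u \<le> code_fm (Eq t u)"
    unfolding code_fm.simps by (rule le_list_encode, simp)+
  with Eq show ?case by (auto dest: tparams_le simp del: code_fm.simps)
next
  case (Imp \<phi> \<psi>)
  have "code_fm \<phi> \<le> code_fm (Imp \<phi> \<psi>)" "code_fm \<psi> \<le> code_fm (Imp \<phi> \<psi>)"
    unfolding code_fm.simps(4) by (rule le_list_encode, simp)+
  with Imp show ?case by (auto simp del: code_fm.simps)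
next
  case (All \<phi>)
  have "code_fm \<phi> \<le> code_fm (All \<phi>)"
    unfolding code_fm.simps(5) by (rule le_list_encode, simp)
  with All show ?case by (auto simp del: code_fm.simps)
qed simp

section \<open>Reinterpreting the names\<close>

text \<open>Changing \<open>h\<close> moves the denotations of the names while the sentence and its
  code stay fixed; the identity gives back \<open>dval\<close>.\<close>

primrec pval :: "(nat \<Rightarrow> nat) \<Rightarrow> nat \<Rightarrow> (nat \<Rightarrow> nat) \<Rightarrow> dterm \<Rightarrow> nat" where
  "pval h P s (Var n) = s n"
| "pval h P s (Par a) = h a"
| "pval h P s PO = P"

lemma dval_pval: "dval P = pval (\<lambda>a. a) P"
proof (intro HOL.ext)
  show "dval P s t = pval (\<lambda>a. a) P s t" for s t by (cases t) simp_all
qed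

lemma pval_cong: "(\<And>a. a \<in> tparams t \<Longrightarrow> h a = h' a) \<Longrightarrow> pval h P s t = pval h' P s t"
  by (cases t) simp_all

lemma sat_pval_cong: "(\<And>a. a \<in> params \<phi> \<Longrightarrow> h a = h' a) \<Longrightarrow> sat E (pval h P) s \<phi> = sat E (pval h' P) s \<phi>"
proof (induction \<phi> arbitrary: s)
  case (Mem t u)
  then show ?case using pval_cong[of t h h'] pval_cong[of u h h'] by simp
next
  case (Eq t u)
  then show ?case using pval_cong[of t h h'] pval_cong[of u h h'] by simp
qed simp_all

text \<open>Term evaluation is left abstract so that the lemma serves both the pure language and the
  language of the diagram.\<close>

lemma sat_iso:
  assumes "bij \<sigma>" and ev: "\<And>s t. ev' (\<sigma> \<circ> s) t = \<sigma> (ev s t)"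
  shows "sat (\<lambda>x y. E (\<sigma> x) (\<sigma> y)) ev s \<phi> \<longleftrightarrow> sat E ev' (\<sigma> \<circ> s) \<phi>"
proof (induction \<phi> arbitrary: s)
  case (Eq t u)
  then show ?case using assms(1) unfolding sat.simps ev by (metis bij_is_inj injD)
next
  case (All \<phi>)
  have lift: "\<sigma> \<circ> case_nat x s = case_nat (\<sigma> x) (\<sigma> \<circ> s)" for x by (auto split: nat.split)
  have "(\<forall>x. sat E ev' (case_nat (\<sigma> x) (\<sigma> \<circ> s)) \<phi>) \<longleftrightarrow> (\<forall>x. sat E ev' (case_nat x (\<sigma> \<circ> s)) \<phi>)"
    using assms(1) by (metis bij_pointE)
  then show ?case unfolding sat.simps All.IH lift .
qed (simp_all only: sat.simps ev simp_thms)

text \<open>Under \<open>d\<close> quantifiers, the variables \<open>d, \<dots>, d + K - 1\<close> replace the parameters below \<open>K\<close>.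
  Variable \<open>d + K\<close> is kept free for the element to be defined, and \<open>d + K + 1\<close> is the partial order.\<close>

primrec tvar :: "nat \<Rightarrow> nat \<Rightarrow> dterm \<Rightarrow> nat" where
  "tvar K d (Var n) = n"
| "tvar K d (Par a) = d + a"
| "tvar K d PO = d + K + 1"

primrec generalize :: "nat \<Rightarrow> nat \<Rightarrow> dterm fm \<Rightarrow> nat fm" where
  "generalize K d (Mem t u) = Mem (tvar K d t) (tvar K d u)"
| "generalize K d (Eq t u) = Eq (tvar K d t) (tvar K d u)"
| "generalize K d Fls = Fls"
| "generalize K d (Imp \<phi> \<psi>) = Imp (generalize K d \<phi>) (generalize K d \<psi>)"
| "generalize K d (All \<phi>) = All (generalize K (Suc d) \<phi>)"

lemma tvar_less: "dvars t \<subseteq> {..<d} \<Longrightarrow> tparams t \<subseteq> {..<K} \<Longrightarrow> tvar K d t < d + K + 2"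
  by (cases t) auto

lemma fvs_generalize:
  "fv dvars \<phi> \<subseteq> {..<d} \<Longrightarrow> params \<phi> \<subseteq> {..<K} \<Longrightarrow> fvs (generalize K d \<phi>) \<subseteq> {..<d + K + 2}"
proof (induction \<phi> arbitrary: d)
  case (Mem t u)
  then show ?case using tvar_less[of t d K] tvar_less[of u d K] by simp
next
  case (Eq t u)
  then show ?case using tvar_less[of t d K] tvar_less[of u d K] by simp
next
  case (All \<phi>)
  have "fv dvars \<phi> \<subseteq> {..<Suc d}"
  proof
    fix n assume "n \<in> fv dvars \<phi>"
    then show "n \<in> {..<Suc d}" using All.prems(1) by (cases n) auto
  qed
  then have "fvs (generalize K (Suc d) \<phi>) \<subseteq> {..<Suc d + K + 2}"
    using All.IH[of "Suc d"] All.prems(2) by simp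
  then show ?case by auto
qed simp_all

lemma sat_tvar:
  assumes "dvars t \<subseteq> {..<d}" "tparams t \<subseteq> {..<K}"
    and "\<And>n. n < d \<Longrightarrow> s' n = s n" "\<And>a. a < K \<Longrightarrow> s' (d + a) = h a" "s' (d + K + 1) = P"
  shows "s' (tvar K d t) = pval h P s t"
  using assms by (cases t) auto

text \<open>Variables below \<open>d\<close> belong to quantifiers already entered. Entering another
  one shifts the blocks for the names and the partial order up by one, hence the induction for all
  \<open>d\<close> at once.\<close>

lemma sat_generalize:
  assumes "fv dvars \<phi> \<subseteq> {..<d}" "params \<phi> \<subseteq> {..<K}"
    and "\<And>n. n < d \<Longrightarrow> s' n = s n" "\<And>a. a < K \<Longrightarrow> s' (d + a) = h a" "s' (d + K + 1) = P"
  shows "sats E s' (generalize K d \<phi>) \<longleftrightarrow> sat E (pval h P) s \<phi>"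
  using assms
proof (induction \<phi> arbitrary: d s s')
  case (Mem t u)
  then show ?case using sat_tvar[of t d K s' s h P] sat_tvar[of u d K s' s h P] by simp
next
  case (Eq t u)
  then show ?case using sat_tvar[of t d K s' s h P] sat_tvar[of u d K s' s h P] by simp
next
  case (Imp \<phi> \<psi>)
  then have "sats E s' (generalize K d \<phi>) \<longleftrightarrow> sat E (pval h P) s \<phi>"
    by (intro Imp.IH(1)) auto
  moreover from Imp have "sats E s' (generalize K d \<psi>) \<longleftrightarrow> sat E (pval h P) s \<psi>"
    by (intro Imp.IH(2)) auto
  ultimately show ?case by simp
next
  case (All \<phi>)
  have "sats E (case_nat x s') (generalize K (Suc d) \<phi>) \<longleftrightarrow> sat E (pval h P) (case_nat x s) \<phi>" for x
  proof (rule All.IH)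
    show "fv dvars \<phi> \<subseteq> {..<Suc d}"
    proof
      fix n assume "n \<in> fv dvars \<phi>"
      then show "n \<in> {..<Suc d}" using All.prems(1) by (cases n) auto
    qed
  qed (use All.prems in \<open>auto split: nat.split\<close>)
  then show ?case by simp
qed simp

lemma fo_fragment:
  assumes "fv dvars \<phi> = {}" "params \<phi> \<subseteq> {..<K}"
  shows "fo (K + 2) (\<lambda>E s. \<forall>s\<^sub>0. sat E (pval s (s (K + 1))) s\<^sub>0 \<phi>)"
proof -
  have "sats E s (generalize K 0 \<phi>) \<longleftrightarrow> sat E (pval s (s (K + 1))) s\<^sub>0 \<phi>"
    for E and s s\<^sub>0 :: "nat \<Rightarrow> nat"
    by (rule sat_generalize) (use assms in auto)
  moreover have "fvs (generalize K 0 \<phi>) \<subseteq> {..<K + 2}"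
    using fvs_generalize[of \<phi> 0 K] assms by simp
  ultimately show ?thesis unfolding fo_def by (intro exI[of _ "generalize K 0 \<phi>"]) blast
qed

section \<open>Defining the realizations of a finite fragment\<close>

lemma fo_Ball:
  assumes "finite I" "\<And>i. i \<in> I \<Longrightarrow> fo N (R i)"
  shows "fo N (\<lambda>E s. \<forall>i\<in>I. R i E s)"
  using assms
proof (induction I rule: finite_induct)
  case empty
  then show ?case using fo_not[OF fo_False] by simp
next
  case (insert i I)
  have "fo N (\<lambda>E s. R i E s \<and> (\<forall>i\<in>I. R i E s))"
    by (intro fo_and) (use insert in auto)
  then show ?case by simp
qed

definition prepend :: "nat \<Rightarrow> (nat \<Rightarrow> nat) \<Rightarrow> (nat \<Rightarrow> nat) \<Rightarrow> nat \<Rightarrow> nat" where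
  "prepend K h s i = (if i < K then h i else s (i - K))"

text \<open>Quantifying over the function \<open>h\<close> amounts to \<open>K\<close> first-order
  quantifiers, because \<open>prepend K\<close> reads \<open>h\<close> only below
  \<open>K\<close>.\<close>

lemma fo_ex_prepend: "fo (K + N) R \<Longrightarrow> fo N (\<lambda>E s. \<exists>h. R E (prepend K h s))"
proof (induction K arbitrary: R)
  case 0
  then show ?case by (simp add: prepend_def)
next
  case (Suc K)
  have eta: "case_nat (s 0) (\<lambda>n. s (Suc n)) = s" for s :: "nat \<Rightarrow> nat"
    by (auto split: nat.split)
  have "fo (K + N) (\<lambda>E s. \<exists>x. R E (case_nat x s))"
    by (rule fo_ex) (use Suc.prems in \<open>simp add: eta\<close>)
  from Suc.IH[OF this] have "fo N (\<lambda>E s. \<exists>h x. R E (case_nat x (prepend K h s)))" .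
  moreover have "(\<exists>h x. R E (case_nat x (prepend K h s))) \<longleftrightarrow> (\<exists>h. R E (prepend (Suc K) h s))" for E s
  proof -
    have 1: "case_nat x (prepend K h s) = prepend (Suc K) (case_nat x h) s" for x h
      by (auto simp: prepend_def split: nat.split)
    have 2: "prepend (Suc K) h s = case_nat (h 0) (prepend K (\<lambda>n. h (Suc n)) s)" for h
      by (auto simp: prepend_def split: nat.split)
    show ?thesis using 1 2 by metis
  qed
  ultimately show ?case by simp
qed


text \<open>Injectivity is demanded because exactly the injective tuples extend to permutations. The
  values \<open>b \<phi>\<close> will be the truth values in one fixed model; in the defining
  formula they are constants.\<close>

lemma fo_realizes_fragment:
  assumes F: "finite F" "\<And>\<phi>. \<phi> \<in> F \<Longrightarrow> fv dvars \<phi> = {} \<and> params \<phi> \<subseteq> {..<K}" and n: "n < K"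
  shows "fo 2 (\<lambda>E s. \<exists>h. inj_on h {..<K} \<and> h n = s 0 \<and>
    (\<forall>\<phi>\<in>F. (\<forall>s\<^sub>0. sat E (pval h (s 1)) s\<^sub>0 \<phi>) \<longleftrightarrow> b \<phi>))"
proof -
  \<comment> \<open>Indices below \<open>K\<close> carry the tuple, \<open>K\<close> the element and
    \<open>K + 1\<close> the partial order; the last two become 0 and 1 once the tuple is quantified
    away.\<close>
  let ?R = "\<lambda>E s. (\<forall>i\<in>{..<K}. \<forall>j\<in>{..<K}. s i = s j \<longrightarrow> i = j) \<and> s n = s K \<and>
    (\<forall>\<phi>\<in>F. (\<forall>s\<^sub>0. sat E (pval s (s (K + 1))) s\<^sub>0 \<phi>) \<longleftrightarrow> b \<phi>)"
  have const: "fo N (\<lambda>E s. Q)" for N Q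
    by (cases Q) (use fo_False[of N] fo_not[OF fo_False[of N]] in simp_all)
  have "fo (K + 2) ?R"
    by (intro fo_and fo_Ball fo_imp fo_eq fo_iff const fo_fragment) (use F n in auto)
  from fo_ex_prepend[OF this] have "fo 2 (\<lambda>E s. \<exists>h. ?R E (prepend K h s))" .
  moreover have "?R E (prepend K h s) \<longleftrightarrow> inj_on h {..<K} \<and> h n = s 0 \<and>
      (\<forall>\<phi>\<in>F. (\<forall>s\<^sub>0. sat E (pval h (s 1)) s\<^sub>0 \<phi>) \<longleftrightarrow> b \<phi>)" for E h s
  proof -
    have "sat E (pval (prepend K h s) (s 1)) s\<^sub>0 \<phi> = sat E (pval h (s 1)) s\<^sub>0 \<phi>" if "\<phi> \<in> F" for s\<^sub>0 \<phi>
      by (rule sat_pval_cong) (use F(2)[OF that] in \<open>auto simp: prepend_def\<close>)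
    then show ?thesis using n by (auto simp: prepend_def inj_on_def)
  qed
  ultimately show ?thesis by simp
qed

text \<open>One value per step is corrected by a transposition. It fixes the earlier
  \<open>h i\<close>, which differ from \<open>h K\<close> by injectivity of \<open>h\<close> and
  from \<open>\<sigma> K\<close> by that of \<sigma>.\<close>

lemma ex_bij_extending:
  assumes "inj_on h {..<K :: nat}"
  shows "\<exists>\<sigma> :: nat \<Rightarrow> nat. bij \<sigma> \<and> (\<forall>i<K. \<sigma> i = h i)"
  using assms
proof (induction K)
  case 0
  then show ?case using bij_id by blast
next
  case (Suc K)
  then obtain \<sigma> where \<sigma>: "bij \<sigma>" "\<And>i. i < K \<Longrightarrow> \<sigma> i = h i" by (auto simp: lessThan_Suc)
  let ?\<tau> = "transpose (\<sigma> K) (h K) \<circ> \<sigma>"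
  have "bij ?\<tau>" using \<sigma>(1) by (simp add: bij_comp)
  moreover have "?\<tau> i = h i" if "i < Suc K" for i
  proof (cases "i = K")
    case False
    then have i: "i < K" using that by simp
    then have "\<sigma> i \<noteq> \<sigma> K" using \<sigma>(1) by (metis bij_is_inj injD less_irrefl)
    moreover have "\<sigma> i \<noteq> h K" using Suc.prems \<sigma>(2) i False by (auto simp: inj_on_def)
    ultimately show ?thesis using \<sigma>(2)[OF i] by simp
  qed simp
  ultimately show ?case by blast
qed

section \<open>Pulling back a model along a permutation\<close>

text \<open>The direction makes \<sigma> itself an isomorphism onto the original structure: the
  number \<open>a\<close> in the copy stands for \<open>\<sigma> a\<close>.\<close>

definition pullback :: "(nat \<Rightarrow> nat) \<Rightarrow> (nat \<Rightarrow> nat \<Rightarrow> bool) \<Rightarrow> nat \<Rightarrow> nat \<Rightarrow> bool" where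
  "pullback \<sigma> E x y \<longleftrightarrow> E (\<sigma> x) (\<sigma> y)"

lemma pullback_eq: "pullback \<sigma> E = (\<lambda>x y. E (\<sigma> x) (\<sigma> y))"
  by (intro HOL.ext) (rule pullback_def)

lemma sats_pullback: "bij \<sigma> \<Longrightarrow> sats (pullback \<sigma> E) s \<phi> \<longleftrightarrow> sats E (\<sigma> \<circ> s) \<phi>"
  unfolding pullback_eq by (rule sat_iso) simp_all

lemma models_ZF_pullback: "bij \<sigma> \<Longrightarrow> models_ZF E \<Longrightarrow> models_ZF (pullback \<sigma> E)"
  unfolding models_ZF_def by (simp add: sats_pullback)

text \<open>Isomorphism invariance of every \<open>fo\<close> property, which settles
  \<open>is_po\<close> without unfolding it.\<close>

lemma fo_pullback: "fo N R \<Longrightarrow> bij \<sigma> \<Longrightarrow> R (pullback \<sigma> E) s \<longleftrightarrow> R E (\<sigma> \<circ> s)"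
  unfolding fo_def using sats_pullback by blast

lemma is_po_pullback: "bij \<sigma> \<Longrightarrow> is_po (pullback \<sigma> E) P \<longleftrightarrow> is_po E (\<sigma> P)"
  using fo_pullback[OF fo_is_po[of 0 1], of \<sigma> E "\<lambda>_. P"] by simp

lemma is_iso_pullback: "bij \<sigma> \<Longrightarrow> is_iso (inv \<sigma>) E P (pullback \<sigma> E) (inv \<sigma> P)"
  unfolding is_iso_def pullback_def by (simp add: bij_imp_bij_inv bij_is_surj surj_f_inv_f)

text \<open>The diagram of the copy can be read off in the original by letting the name
  \<open>a\<close> denote \<open>\<sigma> a\<close>; this links it to the tuples
  \<open>h\<close>.\<close>

lemma true_pullback:
  assumes "bij \<sigma>"
  shows "(\<forall>s. sat (pullback \<sigma> E) (dval (inv \<sigma> P)) s \<phi>) \<longleftrightarrow> (\<forall>s. sat E (pval \<sigma> P) s \<phi>)"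
proof -
  have "pval \<sigma> P (\<sigma> \<circ> s) t = \<sigma> (dval (inv \<sigma> P) s t)" for s t
    using assms by (cases t) (simp_all add: bij_is_surj surj_f_inv_f)
  then have "sat (pullback \<sigma> E) (dval (inv \<sigma> P)) s \<phi> \<longleftrightarrow> sat E (pval \<sigma> P) (\<sigma> \<circ> s) \<phi>" for s
    unfolding pullback_eq by (rule sat_iso[OF assms])
  moreover have "s = \<sigma> \<circ> (inv \<sigma> \<circ> s)" for s :: "nat \<Rightarrow> nat"
    using assms by (simp add: fun_eq_iff bij_is_surj surj_f_inv_f)
  ultimately show ?thesis by metis
qed

lemma code_mem_elementary_diagram:
  "code_fm \<phi> \<in> elementary_diagram E P \<longleftrightarrow> fv dvars \<phi> = {} \<and> (\<forall>s. sat E (dval P) s \<phi>)"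
  unfolding elementary_diagram_def using code_fm_inject by blast

text \<open>Whether \<open>n \<in> G\<close> is decided by finitely many true sentences about a finite tuple containing \<open>n\<close>.
  Any other tuple satisfying them can be moved to the same place by a permutation of \<open>\<nat>\<close>, so that
  equivariance puts the element corresponding to \<open>n\<close> into \<open>G\<close> as well.\<close>

lemma equivariant_output_definable:
  assumes E: "models_ZF E" "is_po E P"
    and total: "\<And>(E :: nat \<Rightarrow> nat \<Rightarrow> bool) P. models_ZF E \<Longrightarrow> is_po E P \<Longrightarrow> \<exists>G. outputs \<Phi> (elementary_diagram E P) G"
    and equivariant: "\<And>(E :: nat \<Rightarrow> nat \<Rightarrow> bool) P (E' :: nat \<Rightarrow> nat \<Rightarrow> bool) P' \<pi> G G'.
       models_ZF E \<Longrightarrow> is_po E P \<Longrightarrow> models_ZF E' \<Longrightarrow> is_po E' P' \<Longrightarrow> is_iso \<pi> E P E' P' \<Longrightarrow>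
       outputs \<Phi> (elementary_diagram E P) G \<Longrightarrow> outputs \<Phi> (elementary_diagram E' P') G' \<Longrightarrow> \<pi> ` G = G'"
    and G: "outputs \<Phi> (elementary_diagram E P) G" and n: "n \<in> G"
  shows "\<exists>\<psi>. n \<in> defset \<psi> E P \<and> defset \<psi> E P \<subseteq> G"
proof -
  have "computes_value \<Phi> (elementary_diagram E P) n 1"
    using G n unfolding outputs_def by metis
  from computes_value_use[OF this] obtain N where N:
    "\<forall>B. (\<forall>k<N. k \<in> elementary_diagram E P \<longleftrightarrow> k \<in> B) \<longrightarrow> computes_value \<Phi> B n 1" ..
  \<comment> \<open>\<open>N\<close> bounds all names in sentences with codes below
    \<open>N\<close>; \<open>Suc n\<close> puts \<open>n\<close> itself into the tuple.\<close>
  let ?K = "N + Suc n"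
  let ?F = "{\<phi>. code_fm \<phi> < N \<and> fv dvars \<phi> = {}}"
  let ?b = "\<lambda>\<phi>. \<forall>s. sat E (dval P) s \<phi>"
  let ?R = "\<lambda>E P x. \<exists>h. inj_on h {..<?K} \<and> h n = x \<and> (\<forall>\<phi>\<in>?F. (\<forall>s. sat E (pval h P) s \<phi>) \<longleftrightarrow> ?b \<phi>)"
  have "finite ?F"
  proof (rule finite_imageD)
    show "finite (code_fm ` ?F)" by (rule finite_subset[of _ "{..<N}"]) auto
    show "inj_on code_fm ?F" by (intro inj_onI code_fm_inject)
  qed
  moreover have params: "params \<phi> \<subseteq> {..<?K}" if "\<phi> \<in> ?F" for \<phi>
    using that params_le[of _ \<phi>] by force
  ultimately have "fo 2 (\<lambda>E s. ?R E (s 1) (s 0))"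
    by (intro fo_realizes_fragment) auto
  then obtain \<psi> where \<psi>: "\<forall>(E :: nat \<Rightarrow> nat \<Rightarrow> bool) s. sats E s \<psi> \<longleftrightarrow> ?R E (s 1) (s 0)"
    unfolding fo_def by blast
  have defset: "x \<in> defset \<psi> E P \<longleftrightarrow> ?R E P x" for x
    unfolding defset_def by (simp add: \<psi>)
  \<comment> \<open>The identity tuple leaves every name with its own meaning.\<close>
  have "?R E P n" by (rule exI[of _ "\<lambda>a. a"]) (simp add: dval_pval)
  moreover have "x \<in> G" if "?R E P x" for x
  proof -
    from that obtain h where h: "inj_on h {..<?K}" "h n = x"
      "\<And>\<phi>. \<phi> \<in> ?F \<Longrightarrow> (\<forall>s. sat E (pval h P) s \<phi>) \<longleftrightarrow> ?b \<phi>" by blast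
    obtain \<sigma> :: "nat \<Rightarrow> nat" where \<sigma>: "bij \<sigma>" "\<And>i. i < ?K \<Longrightarrow> \<sigma> i = h i"
      using ex_bij_extending[OF h(1)] by blast
    let ?E = "pullback \<sigma> E" and ?P = "inv \<sigma> P"
    have ZF: "models_ZF ?E" using \<sigma>(1) E(1) by (rule models_ZF_pullback)
    have po: "is_po ?E ?P" using \<sigma>(1) E(2) by (simp add: is_po_pullback bij_is_surj surj_f_inv_f)
    have "k \<in> elementary_diagram E P \<longleftrightarrow> k \<in> elementary_diagram ?E ?P" if "k < N" for k
    proof (cases "\<exists>\<phi>. k = code_fm \<phi> \<and> fv dvars \<phi> = {}")
      case True
      then obtain \<phi> where "k = code_fm \<phi>" "fv dvars \<phi> = {}" by blast
      with that have \<phi>: "k = code_fm \<phi>" "\<phi> \<in> ?F" by simp_all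
      have "sat E (pval \<sigma> P) s \<phi> = sat E (pval h P) s \<phi>" for s
        by (rule sat_pval_cong) (use params[OF \<phi>(2)] \<sigma>(2) in auto)
      then have "(\<forall>s. sat ?E (dval ?P) s \<phi>) \<longleftrightarrow> ?b \<phi>"
        using true_pullback[OF \<sigma>(1)] h(3)[OF \<phi>(2)] by simp
      then show ?thesis unfolding \<phi>(1) code_mem_elementary_diagram by simp
    next
      \<comment> \<open>A number that codes no sentence belongs to neither diagram.\<close>
      case False
      then show ?thesis unfolding elementary_diagram_def by blast
    qed
    \<comment> \<open>On the same input \<open>n\<close> with the same oracle answers the output is
      again 1; in the copy, however, \<open>n\<close> stands for \<open>x\<close>.\<close>
    then have val: "computes_value \<Phi> (elementary_diagram ?E ?P) n 1" using N by blast
    obtain G' where G': "outputs \<Phi> (elementary_diagram ?E ?P) G'" using total[OF ZF po] by blast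
    then have "1 = (if n \<in> G' then 1 else 0 :: nat)"
      unfolding outputs_def by (intro computes_value_unique[OF val]) simp
    then have "n \<in> G'" by (simp split: if_splits)
    moreover have "inv \<sigma> ` G = G'"
      using equivariant[OF E ZF po is_iso_pullback[OF \<sigma>(1)] G G'] .
    ultimately obtain g where "g \<in> G" "n = inv \<sigma> g" by blast
    then have "\<sigma> n \<in> G" using \<sigma>(1) by (simp add: bij_is_surj surj_f_inv_f)
    then show ?thesis using \<sigma>(2)[of n] h(2) by simp
  qed
  ultimately show ?thesis using defset by blast
qed

text \<open>Directedness of the filter brings every definable set inside the output under the
  avoidance condition on \<open>c\<close>.\<close>

lemma filter_subset_linked: "is_filter E P G \<Longrightarrow> X \<subseteq> G \<Longrightarrow> linked E P X"
  unfolding is_filter_def linked_def by blast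

theorem theorem8p1:
  assumes "consistent ZF"
  shows "\<not> (\<exists>\<Phi> :: machine.
    (\<forall>(E :: nat \<Rightarrow> nat \<Rightarrow> bool) P. models_ZF E \<and> is_po E P \<longrightarrow>
       (\<exists>G. outputs \<Phi> (elementary_diagram E P) G \<and> generic_filter E P G)) \<and>
    (\<forall>(E :: nat \<Rightarrow> nat \<Rightarrow> bool) P (E' :: nat \<Rightarrow> nat \<Rightarrow> bool) P' \<pi> G G'.
       models_ZF E \<and> is_po E P \<and> models_ZF E' \<and> is_po E' P' \<and> is_iso \<pi> E P E' P' \<and>
       outputs \<Phi> (elementary_diagram E P) G \<and> outputs \<Phi> (elementary_diagram E' P') G' \<longrightarrow>
       \<pi> ` G = G'))"
proof (rule notI, elim exE conjE)
  fix \<Phi> :: machine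
  assume total: "\<forall>(E :: nat \<Rightarrow> nat \<Rightarrow> bool) P. models_ZF E \<and> is_po E P \<longrightarrow>
       (\<exists>G. outputs \<Phi> (elementary_diagram E P) G \<and> generic_filter E P G)"
    and equivariant: "\<forall>(E :: nat \<Rightarrow> nat \<Rightarrow> bool) P (E' :: nat \<Rightarrow> nat \<Rightarrow> bool) P' \<pi> G G'.
       models_ZF E \<and> is_po E P \<and> models_ZF E' \<and> is_po E' P' \<and> is_iso \<pi> E P E' P' \<and>
       outputs \<Phi> (elementary_diagram E P) G \<and> outputs \<Phi> (elementary_diagram E' P') G' \<longrightarrow> \<pi> ` G = G'"
  obtain E :: "nat \<Rightarrow> nat \<Rightarrow> bool" and P c where E: "models_ZF E" "is_po E P"
    and dense: "is_dense E P {x. E x c}"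
    and avoid: "\<forall>\<psi>. linked E P (defset \<psi> E P) \<longrightarrow> (\<forall>x. E x c \<longrightarrow> x \<notin> defset \<psi> E P)"
    using ex_model_with_dense_set[OF assms] by (elim exE conjE) (rule that)
  obtain G where G: "outputs \<Phi> (elementary_diagram E P) G" "generic_filter E P G"
    using total E by blast
  then obtain n where n: "n \<in> G" "E n c" using dense unfolding generic_filter_def by blast
  have "\<exists>\<psi>. n \<in> defset \<psi> E P \<and> defset \<psi> E P \<subseteq> G"
  proof (rule equivariant_output_definable[OF E _ _ G(1) n(1)])
    show "\<exists>G. outputs \<Phi> (elementary_diagram E P) G" if "models_ZF E" "is_po E P" for E :: "nat \<Rightarrow> nat \<Rightarrow> bool" and P
      using total that by blast
  next
    fix E :: "nat \<Rightarrow> nat \<Rightarrow> bool" and P and E' :: "nat \<Rightarrow> nat \<Rightarrow> bool" and P' \<pi> G G'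
    assume "models_ZF E" "is_po E P" "models_ZF E'" "is_po E' P'" "is_iso \<pi> E P E' P'"
      "outputs \<Phi> (elementary_diagram E P) G" "outputs \<Phi> (elementary_diagram E' P') G'"
    then show "\<pi> ` G = G'" using equivariant[rule_format, of E P E' P' \<pi> G G'] by simp
  qed
  then obtain \<psi> where \<psi>: "n \<in> defset \<psi> E P" "defset \<psi> E P \<subseteq> G" by blast
  then have "linked E P (defset \<psi> E P)"
    using G(2) filter_subset_linked unfolding generic_filter_def by blast
  with avoid n(2) \<psi>(1) show False by blast
qed

end
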